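(* Let $-\infty<a<b<\infty$ and let $p,q,w:(a,b)\to\mathbb{R}$ be measurable with $p^{-1},q,w\in L^1(a,b)$, $p>0$ and $w\neq 0$ a.e. on $(a,b)$, such that both $\{x\in(a,b):w(x)>0\}$ and $\{x\in(a,b):w(x)<0\}$ have positive Lebesgue measure. Let $\mathcal{D}$ be a selfadjoint domain, let $c(\mathcal{D})$ be the associated constant, and set $$\alpha:=c(\mathcal{D})+\|q_-\|_1,\qquad \beta:=\sqrt{\alpha\bigl(1/\|p^{-1}\|_1+\alpha\bigr)}+\alpha,\qquad \gamma:=\sqrt{2\beta+1/\|p^{-1}\|_1},$$ where $q_-(x):=\min\{0,q(x)\}$. Assume that there exists a real-valued function $g\in \mathrm{AC}[a,b]$ with $g(a)=g(b)=0$ and $g'\in L^2_p(a,b)$ such that $gw>0$ a.e. on $(a,b)$. Let $\varepsilon>0$ be such that $$\mu_{\frac1p}\bigl(\{x\in[a,b]:p(x)g(x)w(x)<\varepsilon\}\bigr)\le\frac{1}{2\gamma^2}.$$ Then every eigenvalue $\lambda\in\mathbb{C}\setminus\mathbb{R}$ of the operator $A(\mathcal{D})$ satisfies $$|\operatorname{Im}\lambda|\le\frac{2}{\varepsilon}\,\beta\,\gamma\,\|g'\|_{p,2}$$ and $$|\operatorname{Re}\lambda|\le\frac{2}{\varepsilon}\bigl(\beta\,\gamma\,\|g'\|_{p,2}+(\beta^2+\gamma^2\|q\|_1)\|g\|_\infty\bigr).$$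
   Context: Function spaces: $\mathrm{AC}[a,b]$ is the set of absolutely continuous functions on $[a,b]$. For a measurable $r:(a,b)\to[0,\infty)$, $\mu_r$ is the measure on $(a,b)$ with $d\mu_r=r\,dt$, $L^2_r(a,b):=L^2((a,b),\mu_r)$, and $\|\cdot\|_{r,2}$ is its norm, i.e. $\|f\|_{r,2}^2=\int_a^b|f|^2r$. $\|\cdot\|_1$ and $\|\cdot\|_\infty$ are the usual $L^1$- and $L^\infty$-norms on $(a,b)$. Differential expression: $\tau(f)=\frac1w\bigl(-(pf')'+qf\bigr)$. The maximal domain $\mathcal{D}_{\max}$ is the set of all $f:(a,b)\to\mathbb{C}$ in $L^2_{|w|}(a,b)$ such that $f$ and $pf'$ are absolutely continuous on $[a,b]$ and $\tau(f)\in L^2_{|w|}(a,b)$. A selfadjoint domain is a set $\mathcal{D}$ of one of the following two forms: (separated) $\mathcal{D}_{\rm sep}(l,r)=\{f\in\mathcal{D}_{\max}:(pf')(a)=lf(a),\ (pf')(b)=rf(b)\}$ with $l,r\in\mathbb{R}\cup\{\infty\}$, where $l=\infty$ (resp. $r=\infty$) means the Dirichlet condition $f(a)=0$ (resp. $f(b)=0$); (coupled) $\mathcal{D}_{\rm coup}(\varphi,R)=\left\{f\in\mathcal{D}_{\max}:\begin{pmatrix}f(b)\\(pf')(b)\end{pmatrix}=e^{i\varphi}R\begin{pmatrix}f(a)\\(pf')(a)\end{pmatrix}\right\}$ with $\varphi\in[0,2\pi)$ and $R=(r_{ij})_{i,j=1}^2\in\mathbb{R}^{2\times2}$, $\det R=1$.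 The constant $c(\mathcal{D})\ge0$ is defined by: $c(\mathcal{D})=|l|+|r|$ if $\mathcal{D}=\mathcal{D}_{\rm sep}(l,r)$ with $l,r\in\mathbb{R}$; $c(\mathcal{D})=|r|$ if $\mathcal{D}=\mathcal{D}_{\rm sep}(\infty,r)$ with $r\in\mathbb{R}$; $c(\mathcal{D})=|l|$ if $\mathcal{D}=\mathcal{D}_{\rm sep}(l,\infty)$ with $l\in\mathbb{R}$; $c(\mathcal{D})=0$ if $\mathcal{D}=\mathcal{D}_{\rm sep}(\infty,\infty)$; $c(\mathcal{D})=\frac{|r_{11}|+|r_{22}|+2}{|r_{12}|}$ if $\mathcal{D}=\mathcal{D}_{\rm coup}(\varphi,R)$ and $r_{12}\ne0$; $c(\mathcal{D})=|r_{11}r_{21}|$ if $\mathcal{D}=\mathcal{D}_{\rm coup}(\varphi,R)$ and $r_{12}=0$. The operator $A(\mathcal{D})$ in $L^2_{|w|}(a,b)$ is $A(\mathcal{D})f=\tau(f)$ with $\operatorname{dom}A(\mathcal{D})=\mathcal{D}$. Thus $\lambda$ is an eigenvalue of $A(\mathcal{D})$ iff there is $\phi\in\mathcal{D}$, $\phi\neq0$, with $-(p\phi')'+q\phi=\lambda w\phi$ a.e. on $(a,b)$. *)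

theory Defs
  imports "HOL-Analysis.Analysis" "HOL-Probability.Essential_Supremum"
begin

text \<open>
  Functions on \<open>(a,b)\<close> or \<open>[a,b]\<close> are total functions on \<open>real\<close>; only their values on the
  interval matter. ``Measurable'' and ``a.e.'' refer to Lebesgue measure. A function on \<open>(a,b)\<close>
  that is absolutely continuous on \<open>[a,b]\<close> is given together with its boundary values.
\<close>

text \<open>
  The finite set \<open>D\<close> of pairs encodes a finite family of non-overlapping subintervals \<open>[u,v]\<close>.
\<close>

definition AC_on :: "real \<Rightarrow> real \<Rightarrow> (real \<Rightarrow> 'a::real_normed_vector) \<Rightarrow> bool" where
  "AC_on a b f \<longleftrightarrow>
     (\<forall>e>0. \<exists>d>0. \<forall>D::(real \<times> real) set.
        finite D \<and> (\<forall>(u,v)\<in>D. a \<le> u \<and> u \<le> v \<and> v \<le> b) \<and>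
        pairwise (\<lambda>(u,v) (u',v'). disjnt {u<..<v} {u'<..<v'}) D \<and>
        (\<Sum>(u,v)\<in>D. v - u) < d
        \<longrightarrow> (\<Sum>(u,v)\<in>D. norm (f v - f u)) < e)"

definition mu :: "real \<Rightarrow> real \<Rightarrow> (real \<Rightarrow> real) \<Rightarrow> real measure" where
  "mu a b r = density (lebesgue_on {a<..<b}) (\<lambda>t. ennreal (r t))"

definition L2 :: "real \<Rightarrow> real \<Rightarrow> (real \<Rightarrow> real) \<Rightarrow> (real \<Rightarrow> 'a::real_normed_vector) set" where
  "L2 a b r = {f. f \<in> borel_measurable (mu a b r) \<and> integrable (mu a b r) (\<lambda>t. (norm (f t))\<^sup>2)}"

definition norm_L2 :: "real \<Rightarrow> real \<Rightarrow> (real \<Rightarrow> real) \<Rightarrow> (real \<Rightarrow> 'a::real_normed_vector) \<Rightarrow> real" where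
  "norm_L2 a b r f = sqrt (\<integral>t. (norm (f t))\<^sup>2 \<partial>mu a b r)"

definition norm_L1 :: "real \<Rightarrow> real \<Rightarrow> (real \<Rightarrow> real) \<Rightarrow> real" where
  "norm_L1 a b f = (\<integral>t. \<bar>f t\<bar> \<partial>lebesgue_on {a<..<b})"

text \<open>\<open>real_of_ereal\<close> sends \<open>\<infinity>\<close> to \<open>0\<close>, so this is only meaningful for essentially bounded \<open>f\<close>.\<close>

definition norm_Linf :: "real \<Rightarrow> real \<Rightarrow> (real \<Rightarrow> real) \<Rightarrow> real" where
  "norm_Linf a b f = real_of_ereal (esssup (lebesgue_on {a<..<b}) (\<lambda>t. ereal \<bar>f t\<bar>))"

text \<open>
  For absolutely continuous \<open>f\<close> the product \<open>pf'\<close> exists only almost everywhere. Its being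
  absolutely continuous on \<open>[a,b]\<close> means that it has an absolutely continuous representative
  \<open>u\<close>, and \<open>(pf')(a)\<close>, \<open>(pf')(b)\<close> are the boundary values of \<open>u\<close>. The representative is unique
  on \<open>[a,b]\<close>, so the choice below is immaterial whenever one exists.
\<close>

definition is_quasi_deriv ::
  "real \<Rightarrow> real \<Rightarrow> (real \<Rightarrow> real) \<Rightarrow> (real \<Rightarrow> complex) \<Rightarrow> (real \<Rightarrow> complex) \<Rightarrow> bool" where
  "is_quasi_deriv a b p f u \<longleftrightarrow>
     AC_on a b u \<and>
     (AE x in lebesgue_on {a<..<b}. u x = of_real (p x) * vector_derivative f (at x))"

definition quasi_deriv ::
  "real \<Rightarrow> real \<Rightarrow> (real \<Rightarrow> real) \<Rightarrow> (real \<Rightarrow> complex) \<Rightarrow> real \<Rightarrow> complex" where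
  "quasi_deriv a b p f = (SOME u. is_quasi_deriv a b p f u)"

lemma AC_on_imp_continuous_on:
  assumes "AC_on a b f"
  shows "continuous_on {a..b} f"
  unfolding continuous_on_iff
proof (intro ballI allI impI)
  fix x e :: real assume x: "x \<in> {a..b}" and "e > 0"
  then obtain d where "d > 0" and d: "\<And>D::(real \<times> real) set.
        finite D \<and> (\<forall>(u,v)\<in>D. a \<le> u \<and> u \<le> v \<and> v \<le> b) \<and>
        pairwise (\<lambda>(u,v) (u',v'). disjnt {u<..<v} {u'<..<v'}) D \<and>
        (\<Sum>(u,v)\<in>D. v - u) < d
        \<longrightarrow> (\<Sum>(u,v)\<in>D. norm (f v - f u)) < e"
    using assms[unfolded AC_on_def, rule_format, OF \<open>e > 0\<close>] by blast
  have "dist (f y) (f x) < e" if y: "y \<in> {a..b}" and "dist y x < d" for y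
    using d[of "{(min x y, max x y)}"] x that
    by (cases "x \<le> y") (auto simp: dist_norm min_def max_def norm_minus_commute)
  then show "\<exists>d>0. \<forall>y\<in>{a..b}. dist y x < d \<longrightarrow> dist (f y) (f x) < e"
    using \<open>d > 0\<close> by blast
qed

lemma is_quasi_deriv_unique:
  assumes "a < b" "is_quasi_deriv a b p f u" "is_quasi_deriv a b p f v" "x \<in> {a..b}"
  shows "u x = v x"
proof -
  have cont: "continuous_on {a..b} (\<lambda>x. u x - v x)"
    using assms by (intro continuous_on_diff AC_on_imp_continuous_on) (auto simp: is_quasi_deriv_def)
  have "AE x in lebesgue_on {a<..<b}. u x - v x = 0"
    using assms(2,3) unfolding is_quasi_deriv_def by auto
  then have ae: "AE x in lebesgue. x \<in> {a<..<b} \<longrightarrow> u x - v x = 0"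
    by (subst (asm) AE_restrict_space_iff) auto
  have zero: "u y - v y = 0" if y: "y \<in> {a<..<b}" for y
  proof (rule ccontr)
    assume "u y - v y \<noteq> 0"
    define S where "S = {a<..<b} \<inter> (\<lambda>x. u x - v x) -` (- {0})"
    have "open S"
      unfolding S_def
      by (rule continuous_open_preimage) (auto intro: continuous_on_subset[OF cont])
    moreover have "y \<in> S" using y \<open>u y - v y \<noteq> 0\<close> by (auto simp: S_def)
    ultimately have "\<not> negligible S" using open_not_negligible by blast
    moreover have "AE x in lebesgue. x \<notin> S"
      using ae by eventually_elim (auto simp: S_def)
    ultimately show False
      using AE_iff_null_sets[of S lebesgue] \<open>open S\<close> by (auto simp: negligible_iff_null_sets)
  qed
  have "closure {a<..<b} = {a..b}" using \<open>a < b\<close> by simp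
  then have "u x - v x = 0"
    using continuous_constant_on_closure[of "{a<..<b}" "\<lambda>x. u x - v x" 0 x] cont zero assms(4)
    by auto
  then show ?thesis by simp
qed

definition tau ::
  "real \<Rightarrow> real \<Rightarrow> (real \<Rightarrow> real) \<Rightarrow> (real \<Rightarrow> real) \<Rightarrow> (real \<Rightarrow> real) \<Rightarrow> (real \<Rightarrow> complex) \<Rightarrow> real \<Rightarrow> complex"
  where
  "tau a b p q w f = (\<lambda>x.
     (- vector_derivative (quasi_deriv a b p f) (at x) + of_real (q x) * f x) / of_real (w x))"

definition D_max ::
  "real \<Rightarrow> real \<Rightarrow> (real \<Rightarrow> real) \<Rightarrow> (real \<Rightarrow> real) \<Rightarrow> (real \<Rightarrow> real) \<Rightarrow> (real \<Rightarrow> complex) set" where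
  "D_max a b p q w =
     {f \<in> L2 a b (\<lambda>t. \<bar>w t\<bar>). AC_on a b f \<and> (\<exists>u. is_quasi_deriv a b p f u) \<and>
        tau a b p q w f \<in> L2 a b (\<lambda>t. \<bar>w t\<bar>)}"

text \<open>\<open>Dirichlet\<close> is the boundary parameter \<open>\<infinity>\<close>.\<close>

datatype bparam = Robin real | Dirichlet

fun satisfies_bparam :: "bparam \<Rightarrow> complex \<Rightarrow> complex \<Rightarrow> bool" where
  "satisfies_bparam (Robin l) y y1 \<longleftrightarrow> y1 = of_real l * y"
| "satisfies_bparam Dirichlet y y1 \<longleftrightarrow> y = 0"

definition D_sep ::
  "real \<Rightarrow> real \<Rightarrow> (real \<Rightarrow> real) \<Rightarrow> (real \<Rightarrow> real) \<Rightarrow> (real \<Rightarrow> real) \<Rightarrow> bparam \<Rightarrow> bparam \<Rightarrow> (real \<Rightarrow> complex) set"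
  where
  "D_sep a b p q w l r =
     {f \<in> D_max a b p q w. satisfies_bparam l (f a) (quasi_deriv a b p f a) \<and>
                            satisfies_bparam r (f b) (quasi_deriv a b p f b)}"

definition D_coup ::
  "real \<Rightarrow> real \<Rightarrow> (real \<Rightarrow> real) \<Rightarrow> (real \<Rightarrow> real) \<Rightarrow> (real \<Rightarrow> real) \<Rightarrow> real \<Rightarrow> real^2^2 \<Rightarrow> (real \<Rightarrow> complex) set"
  where
  "D_coup a b p q w \<phi> R =
     {f \<in> D_max a b p q w.
        (vector [f b, quasi_deriv a b p f b] :: complex^2) =
          exp (\<i> * of_real \<phi>) *s
            ((\<chi> i j. of_real (R $ i $ j)) *v vector [f a, quasi_deriv a b p f a])}"

text \<open>
  A selfadjoint domain is handled through its boundary data; distinct data may describe the same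
  domain (e.g. \<open>Coup \<phi> R\<close> and \<open>Coup (\<phi> + pi) (- R)\<close>), but then the constants agree.
\<close>

datatype sa_data = Sep bparam bparam | Coup real "real^2^2"

fun valid_sa_data :: "sa_data \<Rightarrow> bool" where
  "valid_sa_data (Sep l r) \<longleftrightarrow> True"
| "valid_sa_data (Coup \<phi> R) \<longleftrightarrow> 0 \<le> \<phi> \<and> \<phi> < 2 * pi \<and> det R = 1"

fun sa_domain ::
  "real \<Rightarrow> real \<Rightarrow> (real \<Rightarrow> real) \<Rightarrow> (real \<Rightarrow> real) \<Rightarrow> (real \<Rightarrow> real) \<Rightarrow> sa_data \<Rightarrow> (real \<Rightarrow> complex) set"
  where
  "sa_domain a b p q w (Sep l r) = D_sep a b p q w l r"
| "sa_domain a b p q w (Coup \<phi> R) = D_coup a b p q w \<phi> R"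

fun sa_const :: "sa_data \<Rightarrow> real" where
  "sa_const (Sep (Robin l) (Robin r)) = \<bar>l\<bar> + \<bar>r\<bar>"
| "sa_const (Sep Dirichlet (Robin r)) = \<bar>r\<bar>"
| "sa_const (Sep (Robin l) Dirichlet) = \<bar>l\<bar>"
| "sa_const (Sep Dirichlet Dirichlet) = 0"
| "sa_const (Coup \<phi> R) =
     (if R $ 1 $ 2 \<noteq> 0 then (\<bar>R $ 1 $ 1\<bar> + \<bar>R $ 2 $ 2\<bar> + 2) / \<bar>R $ 1 $ 2\<bar>
      else \<bar>R $ 1 $ 1 * R $ 2 $ 1\<bar>)"

text \<open>
  Eigenvalues of the operator \<open>f \<mapsto> \<tau>(f)\<close> with domain \<open>D\<close> in \<open>L\<^sup>2\<close> with weight \<open>\<bar>w\<bar>\<close>: both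
  the eigenvalue equation and \<open>f \<noteq> 0\<close> are understood up to equality a.e. (the null sets of
  \<open>mu a b \<bar>w\<bar>\<close> are the Lebesgue null sets when \<open>w \<noteq> 0\<close> a.e.).
\<close>

definition is_eigenvalue ::
  "real \<Rightarrow> real \<Rightarrow> (real \<Rightarrow> real) \<Rightarrow> (real \<Rightarrow> real) \<Rightarrow> (real \<Rightarrow> real) \<Rightarrow> (real \<Rightarrow> complex) set \<Rightarrow> complex \<Rightarrow> bool"
  where
  "is_eigenvalue a b p q w D z \<longleftrightarrow>
     (\<exists>f\<in>D. \<not> (AE x in lebesgue_on {a<..<b}. f x = 0) \<and>
             (AE x in lebesgue_on {a<..<b}. tau a b p q w f x = z * f x))"

end

theory Submission
  imports Defs
begin

text \<open>
  Let \<open>f\<close> be an eigenfunction, \<open>u = pf'\<close> and \<open>k\<^sup>2 = \<integral>|f|\<^sup>2/p\<close>. Integrating \<open>(u \<cdot> cnj f)'\<close>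
  gives \<open>\<integral>q|f|\<^sup>2 + \<integral>p|f'|\<^sup>2 - z \<integral>w|f|\<^sup>2 = B\<close> with a boundary term \<open>B\<close> that is real and at most
  \<open>c(D) \<parallel>f\<parallel>\<^sub>\<infinity>\<^sup>2\<close>. As \<open>z\<close> is not real, \<open>\<integral>w|f|\<^sup>2 = 0\<close> and \<open>\<parallel>f'\<parallel>\<^sub>p\<^sup>2 \<le> \<alpha> \<parallel>f\<parallel>\<^sub>\<infinity>\<^sup>2\<close>. Averaging
  \<open>|f(x)|\<^sup>2 - |f(y)|\<^sup>2 \<le> 2 k \<parallel>f'\<parallel>\<^sub>p\<close> over \<open>y\<close> against \<open>dy/p\<close> bounds \<open>\<parallel>f\<parallel>\<^sub>\<infinity>\<^sup>2\<close> by
  \<open>2 k \<parallel>f'\<parallel>\<^sub>p + k\<^sup>2/\<parallel>1/p\<parallel>\<^sub>1\<close>, and the two estimates together give \<open>\<parallel>f'\<parallel>\<^sub>p \<le> \<beta> k\<close> and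
  \<open>\<parallel>f\<parallel>\<^sub>\<infinity> \<le> \<gamma> k\<close>. Finally \<open>\<integral>(g u \<cdot> cnj f)' = 0\<close> expresses \<open>z \<integral>gw|f|\<^sup>2\<close> through quantities bounded
  by these estimates, while the choice of \<open>\<epsilon>\<close> makes \<open>\<integral>gw|f|\<^sup>2 \<ge> \<epsilon>k\<^sup>2/2\<close>.

  The derivatives occurring here are meaningful because absolutely continuous functions are
  differentiable almost everywhere (Austin's variation argument with Vitali's covering theorem) and
  satisfy the fundamental theorem of calculus (a gauge that squeezes the exceptional null set into
  an open set of small measure).
\<close>

section \<open>Differentiability almost everywhere\<close>

lemma sum_increments_le:
  fixes G :: "real \<Rightarrow> real" and s t :: "'i \<Rightarrow> real"
  assumes "finite F" and G: "mono_on {A..B} G" and "A \<le> B"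
    and "\<And>i. i \<in> F \<Longrightarrow> A \<le> s i \<and> s i \<le> t i \<and> t i \<le> B"
    and "pairwise (\<lambda>i j. disjnt {s i..t i} {s j..t j}) F"
  shows "(\<Sum>i\<in>F. G (t i) - G (s i)) \<le> G B - G A"
  using assms
\<comment> \<open>The inserted index has the largest right endpoint, so by disjointness every other
  interval ends before \<open>s x\<close>; the induction hypothesis is therefore applied with
  \<open>B\<close> lowered to \<open>s x\<close>.\<close>
proof (induction F arbitrary: B rule: finite_ranking_induct[where f = t])
  case empty
  then show ?case by (auto simp: mono_on_def)
next
  case (insert x F B)
  show ?case
  proof (cases "x \<in> F")
    case True
    then show ?thesis using insert by (simp add: insert_absorb)
  next
    case False
    have "t y < s x" if "y \<in> F" for y
    proof -
      have "disjnt {s x..t x} {s y..t y}"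
        using insert.prems(4) False that by (auto simp: pairwise_insert)
      then have "t y \<notin> {s x..t x}"
        using insert.prems(3)[of y] that by (auto simp: disjnt_iff)
      then show ?thesis using insert.hyps(2)[OF that] by simp
    qed
    moreover have x: "A \<le> s x" "s x \<le> t x" "t x \<le> B" using insert.prems(3)[of x] by auto
    moreover have "mono_on {A..s x} G" using x by (intro mono_on_subset[OF insert.prems(1)]) auto
    ultimately have "(\<Sum>i\<in>F. G (t i) - G (s i)) \<le> G (s x) - G A"
      using insert.prems(3,4)
      by (intro insert.IH) (auto simp: pairwise_insert intro: less_imp_le)
    moreover have "G (t x) \<le> G B"
      using x by (intro mono_onD[OF insert.prems(1)]) auto
    ultimately show ?thesis using insert.hyps False by simp
  qed
qed

text \<open>Vitali's theorem extracts from the steep intervals a disjoint countable family that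
  covers \<open>E\<close> up to a null set, and its total length is at most the rise of
  \<open>G\<close> divided by \<open>c\<close>. A measurable superset \<open>T\<close> is produced
  because \<open>E\<close> itself is not assumed measurable.\<close>

lemma steep_set_outer_measure_le:
  fixes G :: "real \<Rightarrow> real"
  assumes G: "mono_on {a..b} G" and "a \<le> b" "c > 0"
    and cov: "\<And>x d. x \<in> E \<Longrightarrow> d > 0 \<Longrightarrow>
      \<exists>s t. a \<le> s \<and> s < t \<and> t \<le> b \<and> t - s < d \<and> x \<in> {s..t} \<and> c * (t - s) \<le> G t - G s"
  shows "\<exists>T. E \<subseteq> T \<and> T \<in> lmeasurable \<and> measure lebesgue T \<le> (G b - G a) / c"
proof -
  define K where "K = {(s,t). a \<le> s \<and> s < t \<and> t \<le> b \<and> c * (t - s) \<le> G t - G s}"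
  \<comment> \<open>Midpoint and half-length, since the covering theorem speaks of balls.\<close>
  define m :: "real \<times> real \<Rightarrow> real" where "m = (\<lambda>(s,t). (s + t) / 2)"
  define r :: "real \<times> real \<Rightarrow> real" where "r = (\<lambda>(s,t). (t - s) / 2)"
  have cb: "cball (m i) (r i) = {fst i..snd i}" for i
    by (auto simp: m_def r_def cball_eq_atLeastAtMost split: prod.split; simp add: field_simps)
  have rpos: "0 < r i" if "i \<in> K" for i using that by (auto simp: K_def r_def)
  have "\<exists>i. i \<in> K \<and> x \<in> cball (m i) (r i) \<and> r i < d" if x: "x \<in> E" and d: "d > 0" for x d
  proof -
    obtain s t where "a \<le> s" "s < t" "t \<le> b" "t - s < d" "x \<in> {s..t}" "c * (t - s) \<le> G t - G s"
      using cov[OF x d] by auto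
    then show ?thesis unfolding cb
      by (intro exI[of _ "(s,t)"]) (auto simp: K_def r_def)
  qed
  from Vitali_covering_theorem_cballs[of K r E m, OF rpos this]
  obtain C where C: "countable C" "C \<subseteq> K"
     "pairwise (\<lambda>i j. disjnt (cball (m i) (r i)) (cball (m j) (r j))) C"
     "negligible (E - (\<Union>i \<in> C. cball (m i) (r i)))" .
  define U where "U = (\<Union>i \<in> C. cball (m i) (r i))"
  have fin: "measure lebesgue (\<Union>i \<in> F. cball (m i) (r i)) \<le> (G b - G a) / c"
    if F: "F \<subseteq> C" "finite F" for F
  proof -
    have "measure lebesgue (\<Union>i \<in> F. cball (m i) (r i)) \<le> (\<Sum>i\<in>F. measure lebesgue (cball (m i) (r i)))"
      using F by (intro measure_UNION_le) auto
    also have "\<dots> = (\<Sum>i\<in>F. snd i - fst i)"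
      using F C(2) unfolding cb by (intro sum.cong) (auto simp: K_def)
    also have "\<dots> \<le> (\<Sum>i\<in>F. (G (snd i) - G (fst i)) / c)"
      using F C(2) \<open>c > 0\<close> by (intro sum_mono) (auto simp: K_def field_simps)
    also have "\<dots> = (\<Sum>i\<in>F. G (snd i) - G (fst i)) / c" by (simp add: sum_divide_distrib)
    also have "(\<Sum>i\<in>F. G (snd i) - G (fst i)) \<le> G b - G a"
      using F C \<open>a \<le> b\<close> unfolding cb
      by (intro sum_increments_le[OF _ G]) (auto simp: K_def intro: pairwise_subset)
    finally show ?thesis using \<open>c > 0\<close> by (simp add: divide_right_mono)
  qed
  have U: "U \<in> lmeasurable" "measure lebesgue U \<le> (G b - G a) / c"
    unfolding U_def
    using fmeasurable_UN_bound[OF C(1) _ fin] measure_UN_bound[OF C(1) _ fin] by simp_all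
  have N: "E - U \<in> null_sets lebesgue" using C(4) by (simp add: U_def negligible_iff_null_sets)
  then have "measure lebesgue (U \<union> (E - U)) = measure lebesgue U"
    using U(1) measure_Un_null_set by blast
  moreover have "U \<union> (E - U) \<in> lmeasurable"
    using U N by (metis fmeasurable.Un fmeasurableI_null_sets)
  ultimately show ?thesis using U(2) by (intro exI[of _ "U \<union> (E - U)"]) auto
qed

section \<open>Partitions as inductively built chains, and bounded variation\<close>

inductive chain :: "(real \<Rightarrow> real) \<Rightarrow> real \<Rightarrow> real \<Rightarrow> real \<Rightarrow> bool" for f a where
  start: "chain f a a 0"
| step: "chain f a x s \<Longrightarrow> x \<le> y \<Longrightarrow> chain f a y (s + \<bar>f y - f x\<bar>)"

lemma chain_le: "chain f a x s \<Longrightarrow> a \<le> x"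
  by (induction rule: chain.induct) auto

text \<open>A chain carries the sum of absolute increments along a partition that grows to the
  right. Inserting \<open>c\<close> as a further point can only increase this sum, by the triangle
  inequality; hence an inequality and not an equation.\<close>

lemma chain_split:
  assumes "chain f a y s" "a \<le> c" "c \<le> y"
  shows "\<exists>s1 s2. chain f a c s1 \<and> chain f c y s2 \<and> s \<le> s1 + s2"
  using assms
proof (induction rule: chain.induct)
  case start
  then show ?case using chain.start by force
next
  case (step x s y)
  show ?case
  proof (cases "c \<le> x")
    case True
    then obtain s1 s2 where "chain f a c s1" "chain f c x s2" "s \<le> s1 + s2" using step by auto
    then show ?thesis using step.hyps
      by (intro exI[of _ s1] exI[of _ "s2 + \<bar>f y - f x\<bar>"]) (auto intro: chain.step)
  next
    case False
    then have "chain f a c (s + \<bar>f c - f x\<bar>)"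
      using step.hyps by (intro chain.step) auto
    moreover have "chain f c y (0 + \<bar>f y - f c\<bar>)"
      using step.prems by (intro chain.step chain.start)
    ultimately show ?thesis by (intro exI conjI) (assumption, assumption, linarith)
  qed
qed

lemma chain_imp_family:
  assumes "chain f a y s"
  shows "\<exists>D. finite D \<and> (\<forall>(u,v)\<in>D. a \<le> u \<and> u \<le> v \<and> v \<le> y) \<and>
        pairwise (\<lambda>(u,v) (u',v'). disjnt {u<..<v} {u'<..<v'}) D \<and>
        (\<Sum>(u,v)\<in>D. v - u) = y - a \<and> (\<Sum>(u,v)\<in>D. norm (f v - f u)) = s"
  using assms
proof (induction rule: chain.induct)
  case start
  show ?case by (intro exI[of _ "{}"]) auto
next
  case (step x s y)
  then obtain D where D: "finite D" "\<forall>(u,v)\<in>D. a \<le> u \<and> u \<le> v \<and> v \<le> x"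
        "pairwise (\<lambda>(u,v) (u',v'). disjnt {u<..<v} {u'<..<v'}) D"
        "(\<Sum>(u,v)\<in>D. v - u) = x - a" "(\<Sum>(u,v)\<in>D. norm (f v - f u)) = s"
    by auto
  show ?case
  \<comment> \<open>A step with \<open>x = y\<close> adds nothing and keeps the old family.
    Otherwise \<open>(x,y)\<close> is new, because all old right endpoints are at most
    \<open>x\<close>, so the sums over the set really gain a term.\<close>
  proof (cases "x = y")
    case True
    then show ?thesis using D by auto
  next
    case False
    then have "x < y" using step by auto
    then have "(x,y) \<notin> D" using D(2) by force
    then show ?thesis using D \<open>x < y\<close> chain_le[OF step.hyps(1)]
      by (intro exI[of _ "insert (x,y) D"]) (fastforce simp: pairwise_insert disjnt_iff)
  qed
qed

text \<open>Absolute continuity gives bounded variation: for tolerance 1, a chain over a distance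
  below \<open>d\<close> has sum at most 1, and finitely many pieces of length \<open>d / 2\<close>
  exhaust the interval.\<close>

lemma AC_on_chain_bounded:
  assumes f: "AC_on a b f"
  shows "\<exists>B. \<forall>x s. x \<le> b \<longrightarrow> chain f a x s \<longrightarrow> s \<le> B"
proof -
  obtain d where "d > 0" and d: "\<And>D::(real \<times> real) set.
        finite D \<and> (\<forall>(u,v)\<in>D. a \<le> u \<and> u \<le> v \<and> v \<le> b) \<and>
        pairwise (\<lambda>(u,v) (u',v'). disjnt {u<..<v} {u'<..<v'}) D \<and>
        (\<Sum>(u,v)\<in>D. v - u) < d
        \<longrightarrow> (\<Sum>(u,v)\<in>D. norm (f v - f u)) < 1"
    using f[unfolded AC_on_def, rule_format, of 1] by auto
  have short: "s \<le> 1" if ch: "chain f c y s" "a \<le> c" "y \<le> b" "y - c < d" for c y s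
  proof -
    obtain D where "finite D" "\<forall>(u,v)\<in>D. c \<le> u \<and> u \<le> v \<and> v \<le> y"
        "pairwise (\<lambda>(u,v) (u',v'). disjnt {u<..<v} {u'<..<v'}) D"
        "(\<Sum>(u,v)\<in>D. v - u) = y - c" "(\<Sum>(u,v)\<in>D. norm (f v - f u)) = s"
      using chain_imp_family[OF ch(1)] by (elim exE conjE)
    then show ?thesis using d[of D] ch by fastforce
  qed
  \<comment> \<open>Half of \<open>d\<close> keeps each piece strictly shorter than
    \<open>d\<close>. The successor accounts for the start \<open>n = 0\<close>, where
    \<open>short\<close> still yields only the bound 1.\<close>
  have step: "s \<le> real (Suc n)" if "chain f a y s" "y \<le> b" "y \<le> a + n * (d / 2)" for n y s
    using that
  proof (induction n arbitrary: y s)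
    case 0
    then show ?case using short[of a y s] \<open>d > 0\<close> by auto
  next
    case (Suc n)
    define c where "c = min y (a + n * (d / 2))"
    have "a \<le> c" using chain_le[OF Suc.prems(1)] \<open>d > 0\<close> by (simp add: c_def)
    then obtain s1 s2 where s: "chain f a c s1" "chain f c y s2" "s \<le> s1 + s2"
      using chain_split[OF Suc.prems(1), of c] by (auto simp: c_def)
    have "s1 \<le> real (Suc n)" using Suc.prems by (intro Suc.IH[OF s(1)]) (auto simp: c_def)
    moreover have "s2 \<le> 1"
      using Suc.prems \<open>a \<le> c\<close> \<open>d > 0\<close> by (intro short[OF s(2)]) (auto simp: c_def min_def field_simps)
    ultimately show ?case using s by simp
  qed
  obtain n where "(b - a) / (d / 2) \<le> real n" using real_arch_simple by blast
  then have "b \<le> a + n * (d / 2)" using \<open>d > 0\<close> by (simp add: field_simps)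
  then show ?thesis using step by (intro exI[of _ "real (Suc n)"]) fastforce
qed

text \<open>Linear perturbations, products and nonexpansive images are all obtained from this: an
  estimate for single increments sums over the whole family of intervals.\<close>

lemma AC_on_dominated:
  assumes f: "AC_on a b f" and g: "AC_on a b g"
    and C: "\<And>u v. u \<in> {a..b} \<Longrightarrow> v \<in> {a..b} \<Longrightarrow>
      norm (h v - h u) \<le> C * (norm (f v - f u) + norm (g v - g u))"
  shows "AC_on a b h"
  unfolding AC_on_def
proof (intro allI impI)
  fix e :: real assume "e > 0"
  define c where "c = \<bar>C\<bar> + 1"
  have "c > 0" by (simp add: c_def add_nonneg_pos)
  then have "e / (2 * c) > 0" using \<open>e > 0\<close> by simp
  then obtain d1 where "d1 > 0" and d1: "\<And>D::(real \<times> real) set.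
        finite D \<and> (\<forall>(u,v)\<in>D. a \<le> u \<and> u \<le> v \<and> v \<le> b) \<and>
        pairwise (\<lambda>(u,v) (u',v'). disjnt {u<..<v} {u'<..<v'}) D \<and>
        (\<Sum>(u,v)\<in>D. v - u) < d1
        \<longrightarrow> (\<Sum>(u,v)\<in>D. norm (f v - f u)) < e / (2 * c)"
    using f[unfolded AC_on_def] by meson
  obtain d2 where "d2 > 0" and d2: "\<And>D::(real \<times> real) set.
        finite D \<and> (\<forall>(u,v)\<in>D. a \<le> u \<and> u \<le> v \<and> v \<le> b) \<and>
        pairwise (\<lambda>(u,v) (u',v'). disjnt {u<..<v} {u'<..<v'}) D \<and>
        (\<Sum>(u,v)\<in>D. v - u) < d2
        \<longrightarrow> (\<Sum>(u,v)\<in>D. norm (g v - g u)) < e / (2 * c)"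
    using g[unfolded AC_on_def] \<open>e / (2 * c) > 0\<close> by meson
  have "(\<Sum>(u,v)\<in>D. norm (h v - h u)) < e" if D: "finite D"
        "\<forall>(u,v)\<in>D. a \<le> u \<and> u \<le> v \<and> v \<le> b"
        "pairwise (\<lambda>(u,v) (u',v'). disjnt {u<..<v} {u'<..<v'}) D"
        "(\<Sum>(u,v)\<in>D. v - u) < min d1 d2" for D
  proof -
    have "(\<Sum>(u,v)\<in>D. norm (h v - h u)) \<le> (\<Sum>(u,v)\<in>D. c * norm (f v - f u) + c * norm (g v - g u))"
    proof (intro sum_mono, clarify)
      fix u v assume "(u,v) \<in> D"
      then have "norm (h v - h u) \<le> C * (norm (f v - f u) + norm (g v - g u))"
        using D(2) by (intro C) auto
      also have "\<dots> \<le> c * (norm (f v - f u) + norm (g v - g u))"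
        by (intro mult_right_mono) (auto simp: c_def)
      finally show "norm (h v - h u) \<le> c * norm (f v - f u) + c * norm (g v - g u)"
        by (simp add: distrib_left)
    qed
    also have "\<dots> = c * (\<Sum>(u,v)\<in>D. norm (f v - f u)) + c * (\<Sum>(u,v)\<in>D. norm (g v - g u))"
      by (simp add: sum.distrib sum_distrib_left case_prod_beta)
    also have "\<dots> < c * (e / (2 * c)) + c * (e / (2 * c))"
      using D d1[of D] d2[of D] \<open>c > 0\<close> by (intro add_strict_mono mult_strict_left_mono) auto
    also have "\<dots> = e" using \<open>c > 0\<close> by simp
    finally show ?thesis .
  qed
  then show "\<exists>d>0. \<forall>D. finite D \<and> (\<forall>(u, v)\<in>D. a \<le> u \<and> u \<le> v \<and> v \<le> b) \<and>
               pairwise (\<lambda>(u, v) (u', v'). disjnt {u<..<v} {u'<..<v'}) D \<and>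
               (\<Sum>(u,v)\<in>D. v - u) < d \<longrightarrow>
               (\<Sum>(u,v)\<in>D. norm (h v - h u)) < e"
    using \<open>d1 > 0\<close> \<open>d2 > 0\<close> by (intro exI[of _ "min d1 d2"]) auto
qed

lemma AC_on_ident: "AC_on a b (\<lambda>x. x)"
  unfolding AC_on_def
proof (intro allI impI exI conjI)
  fix e :: real and D :: "(real \<times> real) set"
  assume "e > 0" and D: "finite D \<and> (\<forall>(u,v)\<in>D. a \<le> u \<and> u \<le> v \<and> v \<le> b) \<and>
        pairwise (\<lambda>(u,v) (u',v'). disjnt {u<..<v} {u'<..<v'}) D \<and> (\<Sum>(u,v)\<in>D. v - u) < e"
  have "(\<Sum>(u,v)\<in>D. norm (v - u)) = (\<Sum>(u,v)\<in>D. v - u)" using D by (intro sum.cong) auto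
  then show "(\<Sum>(u,v)\<in>D. norm (v - u)) < e" using D by simp
qed

lemma AC_on_diff_linear:
  fixes f :: "real \<Rightarrow> real"
  assumes f: "AC_on a b f"
  shows "AC_on a b (\<lambda>x. f x - m * x)"
proof (rule AC_on_dominated[OF f AC_on_ident])
  fix u v :: real
  have "norm ((f v - m * v) - (f u - m * u)) = \<bar>(f v - f u) - m * (v - u)\<bar>" by (simp add: algebra_simps)
  also have "\<dots> \<le> \<bar>f v - f u\<bar> + \<bar>m\<bar> * \<bar>v - u\<bar>" by (metis abs_mult abs_triangle_ineq4)
  also have "\<dots> \<le> (1 + \<bar>m\<bar>) * (norm (f v - f u) + norm (v - u))" by (simp add: algebra_simps)
  finally show "norm ((f v - m * v) - (f u - m * u)) \<le> (1 + \<bar>m\<bar>) * (norm (f v - f u) + norm (v - u))" .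
qed

definition variation :: "(real \<Rightarrow> real) \<Rightarrow> real \<Rightarrow> real \<Rightarrow> real" where
  "variation f a x = Sup {s. chain f a x s}"

lemma variation_self: "variation f a a = 0"
proof -
  have "x = a \<longrightarrow> s = 0" if "chain f a x s" for x s
    using that by (induction rule: chain.induct) (auto dest: chain_le)
  then have "{s. chain f a a s} = {0}" using chain.start[of f a] by auto
  then show ?thesis by (simp add: variation_def)
qed

lemma chain_exists: "a \<le> x \<Longrightarrow> \<exists>s. chain f a x s"
  using chain.step[OF chain.start] by blast

text \<open>Every chain to \<open>x\<close> can be prolonged by one step to \<open>y\<close>; the
  estimate follows on taking suprema, which are finite thanks to \<open>B\<close>.\<close>

lemma variation_step:
  assumes bdd: "\<forall>x s. x \<le> b \<longrightarrow> chain f a x s \<longrightarrow> s \<le> B"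
    and "a \<le> x" "x \<le> y" "y \<le> b"
  shows "\<bar>f y - f x\<bar> \<le> variation f a y - variation f a x"
proof -
  have "variation f a x \<le> variation f a y - \<bar>f y - f x\<bar>"
    unfolding variation_def
  proof (rule cSup_least)
    show "{s. chain f a x s} \<noteq> {}" using chain_exists \<open>a \<le> x\<close> by auto
    fix s assume "s \<in> {s. chain f a x s}"
    then have "chain f a y (s + \<bar>f y - f x\<bar>)" using \<open>x \<le> y\<close> by (auto intro: chain.step)
    moreover have "bdd_above {s. chain f a y s}" using bdd \<open>y \<le> b\<close> by (auto simp: bdd_above_def)
    ultimately have "s + \<bar>f y - f x\<bar> \<le> Sup {s. chain f a y s}" by (intro cSup_upper) auto
    then show "s \<le> Sup {s. chain f a y s} - \<bar>f y - f x\<bar>" by simp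
  qed
  then show ?thesis by simp
qed

lemma mono_on_variation:
  assumes "\<forall>x s. x \<le> b \<longrightarrow> chain f a x s \<longrightarrow> s \<le> B"
  shows "mono_on {a..b} (variation f a)"
proof (rule mono_onI)
  fix x y assume "x \<in> {a..b}" "y \<in> {a..b}" "x \<le> y"
  then show "variation f a x \<le> variation f a y"
    using variation_step[OF assms, of x y] by fastforce
qed

text \<open>
  Austin's idea: flipping the sign of \<open>f\<close> piecewise along a chain of nearly maximal sum gives an
  \<open>h\<close> that follows \<open>f\<close> or \<open>- f\<close> locally while \<open>variation - h\<close> stays increasing and gains little.
  Wherever the slopes of \<open>f\<close> oscillate between \<open>c\<close> and \<open>- c\<close>, that difference must be steep.
\<close>

lemma chain_shadow:
  assumes bdd: "\<forall>x s. x \<le> b \<longrightarrow> chain f a x s \<longrightarrow> s \<le> B"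
    and "chain f a x s" "x \<le> b"
  shows "\<exists>h N. h a = 0 \<and> h x = s \<and> mono_on {a..x} (\<lambda>y. variation f a y - h y) \<and> finite N \<and>
    (\<forall>y\<in>{a<..<x} - N. \<exists>\<sigma>\<in>{1,-1}. \<forall>\<^sub>F z in nhds y. h z - h y = \<sigma> * (f z - f y))"
  using assms(2,3)
proof (induction rule: chain.induct)
  case start
  show ?case by (intro exI[of _ "\<lambda>_. 0"] exI[of _ "{}"]) (auto simp: mono_on_def)
next
  case (step x s y)
  then obtain h N where h: "h a = 0" "h x = s" "mono_on {a..x} (\<lambda>y. variation f a y - h y)" "finite N"
    and N: "\<And>y. y \<in> {a<..<x} - N \<Longrightarrow> \<exists>\<sigma>\<in>{1,-1}. \<forall>\<^sub>F z in nhds y. h z - h y = \<sigma> * (f z - f y)"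
    by auto
  \<comment> \<open>With this sign \<open>h'\<close> climbs by exactly
    \<open>\<bar>f y - f x\<bar>\<close> over the new step, which keeps its end value equal to the
    chain sum. The sign can switch only at chain points, and these form the exceptional set.\<close>
  define \<sigma> where "\<sigma> = (if f x \<le> f y then 1 else - 1 :: real)"
  define h' where "h' z = (if z \<le> x then h z else s + \<sigma> * (f z - f x))" for z
  have "a \<le> x" using chain_le[OF step.hyps(1)] .
  have h'y: "h' y = s + \<bar>f y - f x\<bar>"
    using h(2) step.hyps(2) by (auto simp: h'_def \<sigma>_def)
  have late: "h' z = s + \<sigma> * (f z - f x)" if "x \<le> z" for z
    using h(2) that by (auto simp: h'_def)
  have "mono_on {a..y} (\<lambda>z. variation f a z - h' z)"
  proof (rule mono_onI)
    fix z1 z2 assume z: "z1 \<in> {a..y}" "z2 \<in> {a..y}" "z1 \<le> z2"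
    have late_mono: "variation f a u - h' u \<le> variation f a v - h' v" if "x \<le> u" "u \<le> v" "v \<le> y" for u v
    proof -
      have "h' v - h' u = \<sigma> * (f v - f u)"
        using that late[of u] late[of v] by (simp add: algebra_simps)
      also have "\<dots> \<le> \<bar>f v - f u\<bar>" by (auto simp: \<sigma>_def)
      also have "\<dots> \<le> variation f a v - variation f a u"
        using that \<open>a \<le> x\<close> \<open>y \<le> b\<close> by (intro variation_step[OF bdd]) auto
      finally show ?thesis by simp
    qed
    have early_mono: "variation f a u - h' u \<le> variation f a v - h' v" if "a \<le> u" "u \<le> v" "v \<le> x" for u v
      using mono_onD[OF h(3), of u v] that by (auto simp: h'_def)
    consider "z2 \<le> x" | "x \<le> z1" | "z1 \<le> x" "x \<le> z2" by linarith
    then show "variation f a z1 - h' z1 \<le> variation f a z2 - h' z2"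
    proof cases
      case 3
      then show ?thesis using early_mono[of z1 x] late_mono[of x z2] z by auto
    qed (use early_mono late_mono z in auto)
  qed
  moreover have "\<exists>\<sigma>\<in>{1,-1}. \<forall>\<^sub>F z in nhds u. h' z - h' u = \<sigma> * (f z - f u)"
    if u: "u \<in> {a<..<y} - insert x N" for u
  proof (cases "u < x")
    case True
    then have "u \<in> {a<..<x} - N" using u by auto
    from N[OF this] obtain \<tau>
      where "\<tau> \<in> {1,-1}" and ev: "\<forall>\<^sub>F z in nhds u. h z - h u = \<tau> * (f z - f u)" ..
    have "\<forall>\<^sub>F z in nhds u. z < x" using True by (intro eventually_nhds_in_open[of "{..<x}", simplified])
    with ev have "\<forall>\<^sub>F z in nhds u. h' z - h' u = \<tau> * (f z - f u)"
      by eventually_elim (use True in \<open>auto simp: h'_def\<close>)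
    then show ?thesis using \<open>\<tau> \<in> {1,-1}\<close> by blast
  next
    case False
    then have "x < u" using u by auto
    then have "\<forall>\<^sub>F z in nhds u. x < z" by (intro eventually_nhds_in_open[of "{x<..}", simplified])
    then have "\<forall>\<^sub>F z in nhds u. h' z - h' u = \<sigma> * (f z - f u)"
      by eventually_elim (use \<open>x < u\<close> in \<open>auto simp: late algebra_simps\<close>)
    then show ?thesis by (intro bexI[of _ \<sigma>]) (auto simp: \<sigma>_def)
  qed
  ultimately show ?case using h(1,4) h'y \<open>a \<le> x\<close>
    by (intro exI[of _ h'] exI[of _ "insert x N"]) (auto simp: h'_def)
qed

section \<open>Null sets on which difference quotients misbehave\<close>

lemma quotient_swap:
  fixes f :: "real \<Rightarrow> real"
  assumes "y \<noteq> x"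
  shows "(f (max x y) - f (min x y)) / (max x y - min x y) = (f y - f x) / (y - x)"
proof (cases "x \<le> y")
  case False
  then show ?thesis by (simp add: max_def min_def) (metis minus_diff_eq minus_divide_divide)
qed (simp add: max_def min_def)

text \<open>Near a point outside \<open>N\<close> the slopes of \<open>h\<close> are \<sigma> times
  those of \<open>f\<close>. As the latter reach both \<open>c\<close> and \<open>- c\<close>, some
  slopes of \<open>h\<close> are at most \<open>- c\<close> for either sign, and there
  \<open>variation - h\<close> is steep. Its total rise is below \<open>e * c\<close>, so the
  covering estimate leaves outer measure at most \<open>e\<close>.\<close>

lemma AC_on_negligible_oscillation:
  fixes f :: "real \<Rightarrow> real"
  assumes f: "AC_on a b f" and "a \<le> b" "c > 0"
  shows "negligible {x \<in> {a<..<b}. (\<exists>\<^sub>F y in at x. (f y - f x) / (y - x) \<ge> c) \<and>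
                                  (\<exists>\<^sub>F y in at x. (f y - f x) / (y - x) \<le> - c)}"
    (is "negligible ?E")
  unfolding negligible_outer_le
proof (intro allI impI)
  fix e :: real assume "e > 0"
  obtain B where bdd: "\<forall>x s. x \<le> b \<longrightarrow> chain f a x s \<longrightarrow> s \<le> B"
    using AC_on_chain_bounded[OF f] by blast
  have "Sup {s. chain f a b s} - e * c < Sup {s. chain f a b s}" using \<open>e > 0\<close> \<open>c > 0\<close> by simp
  then obtain s where s: "chain f a b s" "variation f a b - e * c < s"
    using less_cSupD[of "{s. chain f a b s}" "Sup {s. chain f a b s} - e * c"] chain_exists[OF \<open>a \<le> b\<close>]
    unfolding variation_def by blast
  obtain h N where h: "h a = 0" "h b = s" "mono_on {a..b} (\<lambda>y. variation f a y - h y)" "finite N"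
    and N: "\<And>y. y \<in> {a<..<b} - N \<Longrightarrow> \<exists>\<sigma>\<in>{1,-1}. \<forall>\<^sub>F z in nhds y. h z - h y = \<sigma> * (f z - f y)"
    using chain_shadow[OF bdd s(1)] by auto
  define G where "G = (\<lambda>y. variation f a y - h y)"
  have "\<exists>T. ?E - N \<subseteq> T \<and> T \<in> lmeasurable \<and> measure lebesgue T \<le> (G b - G a) / c"
  proof (rule steep_set_outer_measure_le[where G = G and a = a and b = b])
    show "mono_on {a..b} G" using h(3) by (simp add: G_def)
    fix x d :: real assume x: "x \<in> ?E - N" and "d > 0"
    then have "x \<in> {a<..<b} - N" by auto
    from N[OF this] obtain \<sigma>
      where \<sigma>: "\<sigma> \<in> {1,-1}" and ev: "\<forall>\<^sub>F z in nhds x. h z - h x = \<sigma> * (f z - f x)" ..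
    have "\<forall>\<^sub>F z in nhds x. z \<in> {a<..<b} \<inter> ball x d" using x \<open>d > 0\<close>
      by (intro eventually_nhds_in_open) auto
    with ev have "\<forall>\<^sub>F z in at x. h z - h x = \<sigma> * (f z - f x) \<and> z \<in> {a<..<b} \<inter> ball x d \<and> z \<noteq> x"
      by (auto simp: eventually_at_filter elim: eventually_elim2)
    moreover have "\<exists>\<^sub>F y in at x. \<sigma> * ((f y - f x) / (y - x)) \<le> - c"
    proof (cases "\<sigma> = 1")
      case False
      then have "\<sigma> = -1" using \<sigma> by simp
      moreover have "\<exists>\<^sub>F y in at x. (f y - f x) / (y - x) \<ge> c" using x by simp
      ultimately show ?thesis unfolding \<open>\<sigma> = -1\<close> by (elim frequently_elim1) linarith
    qed (use x in simp)
    ultimately have "\<exists>\<^sub>F y in at x. (h y - h x = \<sigma> * (f y - f x) \<and> y \<in> {a<..<b} \<inter> ball x d \<and> y \<noteq> x) \<and>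
        \<sigma> * ((f y - f x) / (y - x)) \<le> - c"
      by (rule frequently_eventually_conj[rotated])
    then obtain y where y: "h y - h x = \<sigma> * (f y - f x)" "y \<in> {a<..<b}" "dist x y < d" "y \<noteq> x"
      "\<sigma> * ((f y - f x) / (y - x)) \<le> - c" by (auto dest: frequently_ex)
    define s t where "s = min x y" and "t = max x y"
    have st: "a \<le> s" "s < t" "t \<le> b" "t - s < d" "x \<in> {s..t}"
      using x y by (auto simp: s_def t_def dist_real_def)
    have "\<sigma> * ((f t - f s) / (t - s)) \<le> - c" using y quotient_swap[of y x f] by (simp add: s_def t_def)
    then have "c * (t - s) \<le> - (\<sigma> * (f t - f s))" using st(2) by (simp add: field_simps)
    moreover have "h t - h s = \<sigma> * (f t - f s)"
      using y(1) by (auto simp: s_def t_def max_def min_def algebra_simps)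
    moreover have "\<bar>f t - f s\<bar> \<le> variation f a t - variation f a s"
      using st by (intro variation_step[OF bdd]) auto
    ultimately have "c * (t - s) \<le> G t - G s" by (simp add: G_def)
    with st show "\<exists>s t. a \<le> s \<and> s < t \<and> t \<le> b \<and> t - s < d \<and> x \<in> {s..t} \<and> c * (t - s) \<le> G t - G s"
      by blast
  qed fact+
  then obtain T where T: "?E - N \<subseteq> T" "T \<in> lmeasurable" "measure lebesgue T \<le> (G b - G a) / c" by blast
  have "(G b - G a) / c \<le> e" using s(2) h \<open>c > 0\<close> by (simp add: G_def variation_self field_simps)
  moreover have "N \<in> null_sets lebesgue" using h(4) by (simp add: negligible_iff_null_sets[symmetric] negligible_finite)
  ultimately show "\<exists>T. ?E \<subseteq> T \<and> T \<in> lmeasurable \<and> measure lebesgue T \<le> e"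
    using T by (intro exI[of _ "T \<union> N"])
      (auto simp: measure_Un_null_set fmeasurableD intro: fmeasurable.Un fmeasurableI_null_sets)
qed

text \<open>Here the variation function itself is steep: its increments dominate those of
  \<open>f\<close>, so near such points it has slopes above any \<open>M\<close>, while its total
  rise is finite.\<close>

lemma AC_on_negligible_unbounded_quotient:
  fixes f :: "real \<Rightarrow> real"
  assumes f: "AC_on a b f" and "a \<le> b"
  shows "negligible {x \<in> {a<..<b}. \<forall>M. \<exists>\<^sub>F y in at x. \<bar>(f y - f x) / (y - x)\<bar> \<ge> M}"
    (is "negligible ?E")
  unfolding negligible_outer_le
proof (intro allI impI)
  fix e :: real assume "e > 0"
  obtain B where bdd: "\<forall>x s. x \<le> b \<longrightarrow> chain f a x s \<longrightarrow> s \<le> B"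
    using AC_on_chain_bounded[OF f] by blast
  let ?V = "variation f a"
  have V: "?V b \<ge> 0" using mono_onD[OF mono_on_variation[OF bdd], of a b] \<open>a \<le> b\<close>
    by (simp add: variation_self)
  \<comment> \<open>Chosen so that the covering bound \<open>?V b / M\<close> is at most
    \<open>e\<close>; the summand 1 keeps \<open>M\<close> positive when \<open>?V b\<close> is
    zero.\<close>
  define M where "M = ?V b / e + 1"
  have "M > 0" using V \<open>e > 0\<close> by (simp add: M_def add_nonneg_pos)
  have "\<exists>T. ?E \<subseteq> T \<and> T \<in> lmeasurable \<and> measure lebesgue T \<le> (?V b - ?V a) / M"
  proof (rule steep_set_outer_measure_le[where G = ?V and a = a and b = b])
    show "mono_on {a..b} ?V" using mono_on_variation[OF bdd] by simp
    fix x d :: real assume x: "x \<in> ?E" and "d > 0"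
    have "\<forall>\<^sub>F z in nhds x. z \<in> {a<..<b} \<inter> ball x d" using x \<open>d > 0\<close>
      by (intro eventually_nhds_in_open) auto
    then have "\<forall>\<^sub>F z in at x. z \<in> {a<..<b} \<inter> ball x d \<and> z \<noteq> x"
      by (auto simp: eventually_at_filter elim: eventually_mono)
    moreover have "\<exists>\<^sub>F y in at x. \<bar>(f y - f x) / (y - x)\<bar> \<ge> M"
      using x by auto
    ultimately have "\<exists>\<^sub>F y in at x. (y \<in> {a<..<b} \<inter> ball x d \<and> y \<noteq> x) \<and> \<bar>(f y - f x) / (y - x)\<bar> \<ge> M"
      by (rule frequently_eventually_conj[rotated])
    then obtain y where y: "y \<in> {a<..<b}" "dist x y < d" "y \<noteq> x"
      "\<bar>(f y - f x) / (y - x)\<bar> \<ge> M" by (auto dest: frequently_ex)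
    define s t where "s = min x y" and "t = max x y"
    have st: "a \<le> s" "s < t" "t \<le> b" "t - s < d" "x \<in> {s..t}"
      using x y by (auto simp: s_def t_def dist_real_def)
    have "\<bar>(f t - f s) / (t - s)\<bar> \<ge> M" using y quotient_swap[of y x f] by (simp add: s_def t_def)
    then have "M * (t - s) \<le> \<bar>f t - f s\<bar>" using st(2) by (simp add: field_simps)
    also have "\<dots> \<le> ?V t - ?V s"
      using st by (intro variation_step[OF bdd]) auto
    finally show "\<exists>s t. a \<le> s \<and> s < t \<and> t \<le> b \<and> t - s < d \<and> x \<in> {s..t} \<and> M * (t - s) \<le> ?V t - ?V s"
      using st by blast
  qed fact+
  moreover have "(?V b - ?V a) / M \<le> e"
    using V \<open>e > 0\<close> \<open>M > 0\<close> by (simp add: variation_self M_def field_simps)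
  ultimately show "\<exists>T. ?E \<subseteq> T \<and> T \<in> lmeasurable \<and> measure lebesgue T \<le> e"
    using order_trans by blast
qed

text \<open>The limit is the supremum of the eventual strict lower bounds of \<open>Q\<close>. A
  rational \<open>r\<close> above it is no such bound, so \<open>Q\<close> is frequently at most
  \<open>r\<close>, and the absence of oscillation forces \<open>Q\<close> eventually below any
  rational \<open>s > r\<close>. Rational levels later leave only countably many exceptional
  sets.\<close>

lemma real_limit_exists:
  fixes Q :: "'a \<Rightarrow> real"
  assumes "F \<noteq> bot" and bd: "\<forall>\<^sub>F y in F. \<bar>Q y\<bar> < M"
    and osc: "\<And>r s. r \<in> \<rat> \<Longrightarrow> s \<in> \<rat> \<Longrightarrow> r < s \<Longrightarrow> \<not> ((\<exists>\<^sub>F y in F. Q y \<le> r) \<and> (\<exists>\<^sub>F y in F. Q y \<ge> s))"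
  shows "\<exists>D. (Q \<longlongrightarrow> D) F"
proof -
  define S where "S = {r. \<forall>\<^sub>F y in F. r < Q y}"
  have "- M \<in> S" unfolding S_def using bd by (auto elim: eventually_mono)
  have "r \<le> M" if "r \<in> S" for r
  proof -
    have "\<forall>\<^sub>F y in F. r < Q y \<and> \<bar>Q y\<bar> < M" using that bd by (auto simp: S_def intro: eventually_conj)
    then have "\<exists>y. r < Q y \<and> \<bar>Q y\<bar> < M" using \<open>F \<noteq> bot\<close> eventually_happens by blast
    then show ?thesis by auto
  qed
  then have bdd: "bdd_above S" by (auto simp: bdd_above_def)
  have "(Q \<longlongrightarrow> Sup S) F"
  proof (rule order_tendstoI)
    fix l assume "l < Sup S"
    then obtain r where "r \<in> S" "l < r" using less_cSupD[of S l] \<open>- M \<in> S\<close> by auto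
    then show "\<forall>\<^sub>F y in F. l < Q y" by (auto simp: S_def elim: eventually_mono)
  next
    fix u assume "Sup S < u"
    then obtain s where s: "s \<in> \<rat>" "Sup S < s" "s < u" using Rats_dense_in_real by blast
    then obtain r where r: "r \<in> \<rat>" "Sup S < r" "r < s" using Rats_dense_in_real by blast
    have "r \<notin> S" using cSup_upper[OF _ bdd, of r] r by auto
    then have "\<exists>\<^sub>F y in F. Q y \<le> r" by (simp add: S_def not_eventually not_less)
    then have "\<forall>\<^sub>F y in F. Q y < s" using osc[OF r(1) s(1) r(3)] by (simp add: not_frequently not_le)
    then show "\<forall>\<^sub>F y in F. Q y < u" using s by (auto elim: eventually_mono)
  qed
  then show ?thesis by blast
qed

theorem AC_on_differentiable_AE_real:
  fixes f :: "real \<Rightarrow> real"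
  assumes f: "AC_on a b f" and "a \<le> b"
  shows "negligible {x \<in> {a<..<b}. \<not> f differentiable (at x)}"
proof -
  let ?Q = "\<lambda>x y. (f y - f x) / (y - x)"
  define U where "U = {x \<in> {a<..<b}. \<forall>M. \<exists>\<^sub>F y in at x. \<bar>?Q x y\<bar> \<ge> M}"
  define O' where "O' r s = {x \<in> {a<..<b}. (\<exists>\<^sub>F y in at x. ?Q x y \<le> r) \<and> (\<exists>\<^sub>F y in at x. ?Q x y \<ge> s)}" for r s
  have "negligible U" unfolding U_def using AC_on_negligible_unbounded_quotient[OF assms] .
  moreover have "negligible (O' r s)" if "r < s" for r s
  proof (rule negligible_subset)
    \<comment> \<open>Subtracting the line of slope \<open>?m\<close> turns oscillation between
      \<open>r\<close> and \<open>s\<close> into symmetric oscillation between \<open>- ?c\<close>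
      and \<open>?c\<close>.\<close>
    let ?m = "(r + s) / 2" and ?c = "(s - r) / 2"
    let ?f = "\<lambda>x. f x - ?m * x"
    show "negligible {x \<in> {a<..<b}. (\<exists>\<^sub>F y in at x. (?f y - ?f x) / (y - x) \<ge> ?c) \<and>
                                  (\<exists>\<^sub>F y in at x. (?f y - ?f x) / (y - x) \<le> - ?c)}"
      using that by (intro AC_on_negligible_oscillation AC_on_diff_linear f \<open>a \<le> b\<close>) auto
    have q: "(?f y - ?f x) / (y - x) = ?Q x y - ?m" if "y \<noteq> x" for x y
      using that by (simp add: divide_simps) (simp add: algebra_simps)
    show "O' r s \<subseteq> {x \<in> {a<..<b}. (\<exists>\<^sub>F y in at x. (?f y - ?f x) / (y - x) \<ge> ?c) \<and>
                                  (\<exists>\<^sub>F y in at x. (?f y - ?f x) / (y - x) \<le> - ?c)}"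
    proof (intro subsetI CollectI conjI)
      fix x assume x: "x \<in> O' r s"
      then show "x \<in> {a<..<b}" by (auto simp: O'_def)
      have ne: "\<forall>\<^sub>F y in at x. y \<noteq> x" by (simp add: eventually_at_filter)
      have "\<exists>\<^sub>F y in at x. y \<noteq> x \<and> ?Q x y \<le> r" "\<exists>\<^sub>F y in at x. y \<noteq> x \<and> ?Q x y \<ge> s"
        using x frequently_eventually_conj[OF _ ne] unfolding O'_def by blast+
      then show "\<exists>\<^sub>F y in at x. (?f y - ?f x) / (y - x) \<ge> ?c" "\<exists>\<^sub>F y in at x. (?f y - ?f x) / (y - x) \<le> - ?c"
        by (elim frequently_elim1; elim conjE; subst q; argo)+
    qed
  qed
  moreover have "countable {(r,s). r \<in> \<rat> \<and> s \<in> \<rat> \<and> r < (s::real)}"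
    by (rule countable_subset[of _ "\<rat> \<times> \<rat>"]) (auto intro: countable_SIGMA countable_rat)
  ultimately have neg: "negligible (U \<union> (\<Union>(r,s)\<in>{(r,s). r \<in> \<rat> \<and> s \<in> \<rat> \<and> r < s}. O' r s))"
    by (intro negligible_Un negligible_countable_Union countable_image) auto
  have "{x \<in> {a<..<b}. \<not> f differentiable (at x)} \<subseteq>
    U \<union> (\<Union>(r,s)\<in>{(r,s). r \<in> \<rat> \<and> s \<in> \<rat> \<and> r < s}. O' r s)"
  proof (rule subsetI, rule ccontr)
    fix x assume x: "x \<in> {x \<in> {a<..<b}. \<not> f differentiable (at x)}"
      and n: "x \<notin> U \<union> (\<Union>(r,s)\<in>{(r,s). r \<in> \<rat> \<and> s \<in> \<rat> \<and> r < s}. O' r s)"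
    then have "\<exists>M. \<not> (\<exists>\<^sub>F y in at x. \<bar>?Q x y\<bar> \<ge> M)" by (auto simp: U_def)
    then obtain M where "\<forall>\<^sub>F y in at x. \<bar>?Q x y\<bar> < M" by (auto simp: not_frequently not_le)
    moreover have "\<not> ((\<exists>\<^sub>F y in at x. ?Q x y \<le> r) \<and> (\<exists>\<^sub>F y in at x. ?Q x y \<ge> s))"
      if "r \<in> \<rat>" "s \<in> \<rat>" "r < s" for r s
      using n x that by (auto simp: O'_def)
    ultimately obtain D where "(?Q x \<longlongrightarrow> D) (at x)"
      using real_limit_exists[of "at x" "?Q x" M] by auto
    then have "(f has_field_derivative D) (at x)" by (simp add: has_field_derivative_iff)
    then show False using x real_differentiable_def by blast
  qed
  then show ?thesis using neg negligible_subset by blast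
qed

section \<open>The fundamental theorem of calculus\<close>

text \<open>Henstock's gauge argument: off the null set \<open>N\<close>, differentiability controls
  the error interval by interval. Intervals tagged in \<open>N\<close> lie in an open set of measure
  below \<open>d\<close>, so absolute continuity makes their increments small together.\<close>

theorem AC_on_has_integral:
  fixes F :: "real \<Rightarrow> 'a::banach"
  assumes F: "AC_on a b F" and "a \<le> b" and E: "negligible E"
    and deriv: "\<And>x. x \<in> {a<..<b} - E \<Longrightarrow> (F has_vector_derivative h x) (at x)"
  shows "(h has_integral F b - F a) {a..b}"
proof -
  \<comment> \<open>The endpoints join the exceptional set because derivatives are given only in the
    interior; replacing the integrand by 0 on a null set does not change the integral.\<close>
  define N where "N = E \<union> {a, b}"
  define h0 where "h0 x = (if x \<in> N then 0 else h x)" for x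
  have N: "negligible N" using E by (simp add: N_def negligible_Un)
  have "(h0 has_integral F b - F a) {a..b}"
    unfolding has_integral_real
  proof (intro allI impI)
    fix e :: real assume "e > 0"
    \<comment> \<open>The extra 1 keeps the denominator positive for \<open>a = b\<close> and makes
      \<open>\<epsilon> * (b - a)\<close> strictly less than \<open>e / 2\<close>.\<close>
    define \<epsilon> where "\<epsilon> = e / (2 * (b - a + 1))"
    have "\<epsilon> > 0" using \<open>e > 0\<close> \<open>a \<le> b\<close> by (simp add: \<epsilon>_def)
    have \<epsilon>: "\<epsilon> * (b - a) < e / 2" using \<open>e > 0\<close> \<open>a \<le> b\<close> by (simp add: \<epsilon>_def field_simps)
    obtain d where "d > 0" and d: "\<And>D::(real \<times> real) set.
        finite D \<and> (\<forall>(u,v)\<in>D. a \<le> u \<and> u \<le> v \<and> v \<le> b) \<and>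
        pairwise (\<lambda>(u,v) (u',v'). disjnt {u<..<v} {u'<..<v'}) D \<and>
        (\<Sum>(u,v)\<in>D. v - u) < d
        \<longrightarrow> (\<Sum>(u,v)\<in>D. norm (F v - F u)) < e / 2"
      using F[unfolded AC_on_def, rule_format, of "e / 2"] \<open>e > 0\<close> by auto
    have Nm: "N \<in> null_sets lebesgue" using N by (simp add: negligible_iff_null_sets)
    then obtain T where T: "open T" "N \<subseteq> T" "(T - N) \<in> lmeasurable" "emeasure lebesgue (T - N) < ennreal d"
      using sets_lebesgue_outer_open[OF _ \<open>d > 0\<close>] null_setsD2 by metis
    have "emeasure lebesgue T \<le> emeasure lebesgue (T - N) + emeasure lebesgue N"
      using T Nm by (metis emeasure_subadditive fmeasurableD null_setsD2 Un_Diff_cancel2 Un_absorb2)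
    then have Td: "emeasure lebesgue T < ennreal d" using T(4) Nm by (simp add: null_setsD1)
    have "\<exists>r>0. \<forall>y. norm (y - x) < r \<longrightarrow> norm (F y - F x - (y - x) *\<^sub>R h x) \<le> \<epsilon> * norm (y - x)"
      if "x \<in> {a<..<b} - E" for x
      using deriv[OF that] \<open>\<epsilon> > 0\<close> unfolding has_vector_derivative_def has_derivative_at_alt by blast
    then obtain r where r: "\<And>x. x \<in> {a<..<b} - E \<Longrightarrow> r x > 0"
      "\<And>x y. x \<in> {a<..<b} - E \<Longrightarrow> norm (y - x) < r x \<Longrightarrow> norm (F y - F x - (y - x) *\<^sub>R h x) \<le> \<epsilon> * norm (y - x)"
      by metis
    \<comment> \<open>The last branch only makes the gauge total: its points lie outside
      \<open>{a..b}\<close> and are never tags.\<close>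
    define \<gamma> where "\<gamma> x = (if x \<in> N then T else if x \<in> {a<..<b} then ball x (r x) else UNIV)" for x
    have "gauge \<gamma>"
      unfolding gauge_def \<gamma>_def using T r(1) by (auto simp: N_def)
    moreover have "norm ((\<Sum>(x,k)\<in>p. measure lborel k *\<^sub>R h0 x) - (F b - F a)) < e"
      if p: "p tagged_division_of {a..b}" and fine: "\<gamma> fine p" for p
    proof -
      have "finite p" using p by blast
      have k: "Inf k \<le> x" "x \<le> Sup k" "Inf k \<in> \<gamma> x" "Sup k \<in> \<gamma> x" "a \<le> Inf k" "Inf k \<le> Sup k" "Sup k \<le> b"
          "measure lborel k = Sup k - Inf k" "k \<subseteq> \<gamma> x" "{Inf k..Sup k} = k" if xk: "(x,k) \<in> p" for x k
      proof -
        obtain u v where uv: "k = cbox u v" using tagged_division_ofD(4)[OF p xk] by blast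
        have "x \<in> k" "k \<subseteq> {a..b}" using tagged_division_ofD(2,3)[OF p xk] by auto
        moreover from this have "u \<le> v" using uv by auto
        ultimately show "Inf k \<le> x" "x \<le> Sup k" "Inf k \<in> \<gamma> x" "Sup k \<in> \<gamma> x" "a \<le> Inf k" "Inf k \<le> Sup k" "Sup k \<le> b"
          "measure lborel k = Sup k - Inf k" "k \<subseteq> \<gamma> x" "{Inf k..Sup k} = k"
          using uv fineD[OF fine xk] by auto
      qed
      define pE where "pE = {(x,k) \<in> p. x \<in> N}"
      \<comment> \<open>Degenerate intervals contribute zero and are discarded. Nondegenerate ones
        with disjoint interiors have distinct endpoint pairs, so forgetting the tags (the map
        \<open>I\<close> below) is injective and loses no term of the sum.\<close>
      define pN where "pN = {(x,k) \<in> pE. Inf k < Sup k}"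
      have sub: "pE \<subseteq> p" "pN \<subseteq> pE" by (auto simp: pE_def pN_def)
      have fin: "finite pE" "finite pN" using \<open>finite p\<close> sub by (auto intro: finite_subset)
      let ?\<Delta> = "\<lambda>k. F (Sup k) - F (Inf k)"
      have "(\<Sum>(x,k)\<in>p. measure lborel k *\<^sub>R h0 x) - (F b - F a) = (\<Sum>(x,k)\<in>p. measure lborel k *\<^sub>R h0 x - ?\<Delta> k)"
        using additive_tagged_division_1[OF \<open>a \<le> b\<close> p, of F]
        by (simp add: sum_subtractf case_prod_beta)
      also have "norm \<dots> \<le> (\<Sum>(x,k)\<in>p. norm (measure lborel k *\<^sub>R h0 x - ?\<Delta> k))"
        by (intro sum_norm_le) auto
      also have "\<dots> = (\<Sum>(x,k)\<in>p - pE. norm (measure lborel k *\<^sub>R h0 x - ?\<Delta> k)) + (\<Sum>(x,k)\<in>pE. norm (measure lborel k *\<^sub>R h0 x - ?\<Delta> k))"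
        using sub \<open>finite p\<close> by (intro sum.subset_diff) auto
      also have "(\<Sum>(x,k)\<in>p - pE. norm (measure lborel k *\<^sub>R h0 x - ?\<Delta> k)) \<le> (\<Sum>(x,k)\<in>p - pE. \<epsilon> * measure lborel k)"
      proof (intro sum_mono, clarify)
        fix x k assume xk: "(x,k) \<in> p" "(x,k) \<notin> pE"
        then have "x \<notin> N" by (auto simp: pE_def)
        moreover have "x \<in> {a..b}" using k(1,2,5,7)[OF xk(1)] by auto
        ultimately have x: "x \<in> {a<..<b} - E" by (auto simp: N_def)
        define u v where "u = Inf k" and "v = Sup k"
        have uv: "u \<le> x" "x \<le> v" "measure lborel k = v - u" "u \<in> ball x (r x)" "v \<in> ball x (r x)"
          using k(1-4,8)[OF xk(1)] x \<open>x \<notin> N\<close> unfolding u_def v_def \<gamma>_def by auto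
        have "norm (measure lborel k *\<^sub>R h0 x - ?\<Delta> k)
          = norm ((F u - F x - (u - x) *\<^sub>R h x) - (F v - F x - (v - x) *\<^sub>R h x))"
          unfolding uv(3) using \<open>x \<notin> N\<close>
          by (simp add: h0_def u_def[symmetric] v_def[symmetric] algebra_simps)
        also have "\<dots> \<le> norm (F u - F x - (u - x) *\<^sub>R h x) + norm (F v - F x - (v - x) *\<^sub>R h x)"
          by (rule norm_triangle_ineq4)
        also have "\<dots> \<le> \<epsilon> * norm (u - x) + \<epsilon> * norm (v - x)"
          using uv(4,5) by (intro add_mono r(2)[OF x]) (auto simp: dist_norm norm_minus_commute)
        also have "\<dots> = \<epsilon> * measure lborel k" unfolding uv(3) using uv(1,2) by (simp add: algebra_simps)
        finally show "norm (measure lborel k *\<^sub>R h0 x - ?\<Delta> k) \<le> \<epsilon> * measure lborel k" .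
      qed
      also have "\<dots> \<le> (\<Sum>(x,k)\<in>p. \<epsilon> * measure lborel k)"
        using \<open>finite p\<close> \<open>\<epsilon> > 0\<close> by (intro sum_mono2) auto
      also have "\<dots> = \<epsilon> * (b - a)"
        using additive_content_tagged_division[of p a b] p \<open>a \<le> b\<close>
        by (simp add: sum_distrib_left[symmetric] case_prod_beta)
      also have "(\<Sum>(x,k)\<in>pE. norm (measure lborel k *\<^sub>R h0 x - ?\<Delta> k)) = (\<Sum>(x,k)\<in>pE. norm (?\<Delta> k))"
        by (intro sum.cong) (auto simp: pE_def h0_def norm_minus_commute)
      also have "\<dots> = (\<Sum>(x,k)\<in>pN. norm (?\<Delta> k))"
      proof (intro sum.mono_neutral_right ballI)
        fix i assume "i \<in> pE - pN"
        then obtain x k' where i: "i = (x,k')" "(x,k') \<in> p" "\<not> Inf k' < Sup k'" by (auto simp: pE_def pN_def)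
        then have "Inf k' = Sup k'" using k(6)[OF i(2)] by auto
        then show "(case i of (x,k) \<Rightarrow> norm (?\<Delta> k)) = 0" using i by simp
      qed (use fin sub in auto)
      also have "\<dots> < e / 2"
      proof -
        define I where "I = (\<lambda>(x::real,k::real set). (Inf k, Sup k))"
        have disj: "disjnt {Inf k<..<Sup k} {Inf k'<..<Sup k'}"
          if xk: "(x,k) \<in> pN" "(x',k') \<in> pN" "(x,k) \<noteq> (x',k')" for x k x' k'
        proof -
          have in_p: "(x,k) \<in> p" "(x',k') \<in> p" using xk sub by auto
          have "interior k \<inter> interior k' = {}" using tagged_division_ofD(5)[OF p in_p] xk(3) by blast
          moreover have "interior k = {Inf k<..<Sup k}" "interior k' = {Inf k'<..<Sup k'}"
            using k(10)[OF in_p(1)] k(10)[OF in_p(2)] by (metis interior_atLeastAtMost_real)+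
          ultimately show ?thesis by (simp add: disjnt_def)
        qed
        have inj: "inj_on I pN"
        proof (rule inj_onI, rule ccontr)
          fix i j assume ij: "i \<in> pN" "j \<in> pN" "I i = I j" "i \<noteq> j"
          obtain x k x' k' where eq: "i = (x,k)" "j = (x',k')" by (cases i, cases j)
          have "disjnt {Inf k<..<Sup k} {Inf k'<..<Sup k'}" using disj ij eq by blast
          then have "{Inf k<..<Sup k} = {}" using ij eq by (simp add: I_def disjnt_def)
          then show False using ij eq by (auto simp: pN_def)
        qed
        let ?D = "I ` pN"
        have "(\<Sum>(u,v)\<in>?D. norm (F v - F u)) = (\<Sum>(x,k)\<in>pN. norm (?\<Delta> k))"
          by (subst sum.reindex[OF inj]) (auto simp: I_def intro!: sum.cong)
        moreover have "(\<Sum>(u,v)\<in>?D. norm (F v - F u)) < e / 2"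
        proof (rule d[rule_format, of ?D], intro conjI)
          show "finite ?D" using fin by simp
          show le: "\<forall>(u,v)\<in>?D. a \<le> u \<and> u \<le> v \<and> v \<le> b" using k(5-7) sub by (fastforce simp: I_def)
          show pw: "pairwise (\<lambda>(u,v) (u',v'). disjnt {u<..<v} {u'<..<v'}) ?D"
            unfolding pairwise_def I_def using disj by auto
          have "ennreal (\<Sum>(u,v)\<in>?D. v - u) = (\<Sum>(u,v)\<in>?D. ennreal (v - u))"
            using le by (subst sum_ennreal[symmetric]) (auto simp: case_prod_beta)
          also have "\<dots> = (\<Sum>i\<in>?D. emeasure lebesgue {fst i<..<snd i})"
            using le by (intro sum.cong) auto
          also have "\<dots> = emeasure lebesgue (\<Union>i\<in>?D. {fst i<..<snd i})"
          proof (rule sum_emeasure)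
            show "disjoint_family_on (\<lambda>i. {fst i<..<snd i}) ?D"
              using pw by (simp add: disjoint_family_on_def pairwise_def disjnt_def case_prod_beta)
          qed (use fin in auto)
          also have "\<dots> \<le> emeasure lebesgue T"
          proof (rule emeasure_mono)
            show "(\<Union>i\<in>?D. {fst i<..<snd i}) \<subseteq> T"
            proof (rule UN_least)
              fix i assume "i \<in> ?D"
              then obtain x k' where i: "i = (Inf k', Sup k')" "(x,k') \<in> pN" by (auto simp: I_def)
              then have "(x,k') \<in> p" "x \<in> N" by (auto simp: pN_def pE_def)
              then have "{Inf k'..Sup k'} \<subseteq> T" using k(9,10)[of x k'] by (auto simp: \<gamma>_def)
              then show "{fst i<..<snd i} \<subseteq> T" using i(1) by (auto simp: subset_iff)
            qed
          qed (use T in auto)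
          also have "\<dots> < ennreal d" by fact
          finally show "(\<Sum>(u,v)\<in>?D. v - u) < d"
            using \<open>d > 0\<close> by (meson ennreal_leI not_le)
        qed
        ultimately show ?thesis by simp
      qed
      finally show ?thesis using \<epsilon> by simp
    qed
    ultimately show "\<exists>\<gamma>. gauge \<gamma> \<and> (\<forall>p. p tagged_division_of {a..b} \<and> \<gamma> fine p \<longrightarrow>
        norm ((\<Sum>(x,k)\<in>p. measure lborel k *\<^sub>R h0 x) - (F b - F a)) < e)"
      by (intro exI[of _ \<gamma>] conjI allI impI) auto
  qed
  then show ?thesis
    by (rule has_integral_spike[OF N, rotated]) (auto simp: h0_def)
qed

section \<open>Closure properties of absolute continuity and the Lebesgue form of the fundamental
  theorem\<close>

lemma AC_on_subinterval:
  assumes "AC_on a b f" "a \<le> c" "d \<le> b"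
  shows "AC_on c d f"
  unfolding AC_on_def
proof (intro allI impI)
  fix e :: real assume "e > 0"
  then obtain \<delta> where "\<delta> > 0" and \<delta>: "\<And>D::(real \<times> real) set.
        finite D \<and> (\<forall>(u,v)\<in>D. a \<le> u \<and> u \<le> v \<and> v \<le> b) \<and>
        pairwise (\<lambda>(u,v) (u',v'). disjnt {u<..<v} {u'<..<v'}) D \<and>
        (\<Sum>(u,v)\<in>D. v - u) < \<delta>
        \<longrightarrow> (\<Sum>(u,v)\<in>D. norm (f v - f u)) < e"
    using assms(1)[unfolded AC_on_def, rule_format, OF \<open>e > 0\<close>] by blast
  have "(\<Sum>(u,v)\<in>D. norm (f v - f u)) < e" if D: "finite D" "\<forall>(u,v)\<in>D. c \<le> u \<and> u \<le> v \<and> v \<le> d"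
        "pairwise (\<lambda>(u,v) (u',v'). disjnt {u<..<v} {u'<..<v'}) D" "(\<Sum>(u,v)\<in>D. v - u) < \<delta>" for D
  proof -
    have "\<forall>(u,v)\<in>D. a \<le> u \<and> u \<le> v \<and> v \<le> b" using D(2) assms(2,3) by fastforce
    then show ?thesis using \<delta>[of D] D by blast
  qed
  then show "\<exists>\<delta>>0. \<forall>D::(real \<times> real) set. finite D \<and> (\<forall>(u,v)\<in>D. c \<le> u \<and> u \<le> v \<and> v \<le> d) \<and>
        pairwise (\<lambda>(u,v) (u',v'). disjnt {u<..<v} {u'<..<v'}) D \<and>
        (\<Sum>(u,v)\<in>D. v - u) < \<delta> \<longrightarrow> (\<Sum>(u,v)\<in>D. norm (f v - f u)) < e"
    using \<open>\<delta> > 0\<close> by blast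
qed

lemma AC_on_bounded:
  assumes "AC_on a b f"
  shows "\<exists>M>0. \<forall>x\<in>{a..b}. norm (f x) \<le> M"
  using compact_imp_bounded[OF compact_continuous_image[OF AC_on_imp_continuous_on[OF assms] compact_Icc]]
  by (auto simp: bounded_pos)

lemma AC_on_mult:
  fixes f g :: "real \<Rightarrow> 'a::real_normed_algebra"
  assumes f: "AC_on a b f" and g: "AC_on a b g"
  shows "AC_on a b (\<lambda>x. f x * g x)"
proof -
  obtain M1 where M1: "M1 > 0" "\<And>x. x \<in> {a..b} \<Longrightarrow> norm (f x) \<le> M1" using AC_on_bounded[OF f] by blast
  obtain M2 where M2: "M2 > 0" "\<And>x. x \<in> {a..b} \<Longrightarrow> norm (g x) \<le> M2" using AC_on_bounded[OF g] by blast
  show ?thesis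
  proof (rule AC_on_dominated[OF f g])
    fix u v assume uv: "u \<in> {a..b}" "v \<in> {a..b}"
    have "norm (f v * g v - f u * g u) = norm ((f v - f u) * g v + f u * (g v - g u))"
      by (simp add: algebra_simps)
    also have "\<dots> \<le> norm (f v - f u) * norm (g v) + norm (f u) * norm (g v - g u)"
      by (intro norm_triangle_le add_mono norm_mult_ineq)
    also have "\<dots> \<le> norm (f v - f u) * (M1 + M2) + (M1 + M2) * norm (g v - g u)"
      using M1 M2 uv by (intro add_mono mult_mono) (auto intro: order_trans add_increasing add_increasing2)
    finally show "norm (f v * g v - f u * g u) \<le> (M1 + M2) * (norm (f v - f u) + norm (g v - g u))"
      by (simp add: algebra_simps)
  qed
qed

lemma AC_on_nonexpansive:
  assumes f: "AC_on a b f" and "\<And>x y. norm (\<phi> x - \<phi> y) \<le> norm (x - y)"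
  shows "AC_on a b (\<lambda>x. \<phi> (f x))"
  by (rule AC_on_dominated[OF f f, of _ 1]) (simp, metis assms(2) add_increasing2 norm_ge_zero mult_2)

lemma AC_on_cnj: "AC_on a b f \<Longrightarrow> AC_on a b (\<lambda>x. cnj (f x))"
  by (rule AC_on_nonexpansive) (auto simp flip: complex_cnj_diff)

lemma AC_on_of_real: "AC_on a b f \<Longrightarrow> AC_on a b (\<lambda>x. complex_of_real (f x))"
  by (rule AC_on_nonexpansive[where \<phi> = complex_of_real]) (auto simp flip: of_real_diff)

lemma AE_lebesgue_on_iff_negligible:
  fixes S :: "real set"
  assumes "open S"
  shows "(AE x in lebesgue_on S. P x) \<longleftrightarrow> negligible {x \<in> S. \<not> P x}"
proof -
  have "S \<in> sets lebesgue" using assms by simp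
  then have "(AE x in lebesgue_on S. P x) \<longleftrightarrow> (AE x in lebesgue. x \<in> S \<longrightarrow> P x)"
    by (subst AE_restrict_space_iff) auto
  also have "\<dots> \<longleftrightarrow> {x \<in> S. \<not> P x} \<in> null_sets lebesgue"
    by (simp add: completion.AE_iff_null_sets)
  finally show ?thesis by (simp add: negligible_iff_null_sets)
qed

lemma AC_on_differentiable_AE:
  fixes f :: "real \<Rightarrow> complex"
  assumes f: "AC_on a b f" and "a \<le> b"
  shows "AE x in lebesgue_on {a<..<b}. f differentiable (at x)"
proof -
  have "AC_on a b (\<lambda>x. Re (f x))" "AC_on a b (\<lambda>x. Im (f x))"
    using f by (auto intro!: AC_on_nonexpansive[where f = f] simp: abs_Re_le_cmod abs_Im_le_cmod simp flip: minus_complex.sel)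
  then have "AE x in lebesgue_on {a<..<b}. (\<lambda>x. Re (f x)) differentiable (at x)"
    "AE x in lebesgue_on {a<..<b}. (\<lambda>x. Im (f x)) differentiable (at x)"
    using AC_on_differentiable_AE_real \<open>a \<le> b\<close> by (auto simp: AE_lebesgue_on_iff_negligible)
  then show ?thesis
  proof eventually_elim
    case (elim x)
    then obtain r i where "((\<lambda>x. Re (f x)) has_field_derivative r) (at x)"
      "((\<lambda>x. Im (f x)) has_field_derivative i) (at x)" by (auto simp: real_differentiable_def)
    then have "(f has_vector_derivative Complex r i) (at x)"
      by (simp add: has_vector_derivative_complex_iff)
    then show ?case by (rule differentiableI_vector)
  qed
qed

lemma AC_on_lebesgue_integral:
  fixes F :: "real \<Rightarrow> 'a::euclidean_space"
  assumes F: "AC_on a b F" and "a \<le> b" and int: "integrable (lebesgue_on {a<..<b}) h"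
    and deriv: "AE x in lebesgue_on {a<..<b}. (F has_vector_derivative h x) (at x)"
  shows "(\<integral>x. h x \<partial>lebesgue_on {a<..<b}) = F b - F a"
proof -
  have "(h has_integral F b - F a) {a..b}"
    using deriv by (intro AC_on_has_integral[OF F \<open>a \<le> b\<close>]) (auto simp: AE_lebesgue_on_iff_negligible)
  then have "(h has_integral F b - F a) {a<..<b}"
    by (simp add: has_integral_Icc_iff_Ioo)
  moreover have "(h has_integral (\<integral>x. h x \<partial>lebesgue_on {a<..<b})) {a<..<b}"
    using int by (intro has_integral_integral_lebesgue_on) auto
  ultimately show ?thesis using has_integral_unique by blast
qed

section \<open>Solutions of the eigenvalue equation\<close>

lemma le_sqrt_mult_of_AM_GM:
  fixes A B c :: real
  assumes "A \<ge> 0" "B \<ge> 0" and le: "\<And>t. t > 0 \<Longrightarrow> 2 * c \<le> t * A + B / t"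
  shows "c \<le> sqrt A * sqrt B"
proof (cases "c > 0")
  case True
  show ?thesis
  proof (cases "A = 0")
    case True
    \<comment> \<open>With \<open>A = 0\<close> a large \<open>t\<close> refutes
      \<open>c > 0\<close>: this one makes \<open>B / t\<close> at most \<open>c\<close>, whereas
      the hypothesis demands \<open>2 * c\<close>.\<close>
    have t: "B / c + 1 > 0" using \<open>B \<ge> 0\<close> \<open>c > 0\<close> by (simp add: add_nonneg_pos)
    have "B / (B / c + 1) \<le> c"
      using t \<open>c > 0\<close> by (simp add: pos_divide_le_eq distrib_left)
    then show ?thesis using le[OF t] True \<open>c > 0\<close> by simp
  next
    case False
    \<comment> \<open>The choice \<open>t = c / A\<close> turns the first summand into
      \<open>c\<close> and leaves \<open>c \<le> A * B / c\<close>.\<close>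
    then have "2 * c \<le> c / A * A + B / (c / A)" using assms(1) \<open>c > 0\<close> by (intro le) simp
    then have "c\<^sup>2 \<le> A * B" using False \<open>c > 0\<close> by (simp add: field_simps power2_eq_square)
    then have "c \<le> sqrt (A * B)" by (simp add: real_le_rsqrt)
    then show ?thesis by (simp add: real_sqrt_mult)
  qed
qed (use assms in \<open>simp add: order_trans[of c 0]\<close>)

text \<open>AM-GM bounds \<open>2 * Z\<close> pointwise by \<open>t * X + Y / t\<close> for every
  \<open>t > 0\<close>; integrate, then optimise over \<open>t\<close>. Stated with
  \<open>(Z x)\<^sup>2\<close> and a product, so that weights such as \<open>p\<close> and
  \<open>1 / p\<close> can cancel between the factors.\<close>

lemma integral_Cauchy_Schwarz:
  fixes X Y Z :: "'a \<Rightarrow> real"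
  assumes "integrable M X" "integrable M Y" "integrable M Z"
    and AE: "AE x in M. X x \<ge> 0 \<and> Y x \<ge> 0 \<and> (Z x)\<^sup>2 \<le> X x * Y x"
  shows "(\<integral>x. Z x \<partial>M) \<le> sqrt (\<integral>x. X x \<partial>M) * sqrt (\<integral>x. Y x \<partial>M)"
proof (rule le_sqrt_mult_of_AM_GM)
  show "(\<integral>x. X x \<partial>M) \<ge> 0" "(\<integral>x. Y x \<partial>M) \<ge> 0"
    using AE by (auto intro: integral_nonneg_AE elim: eventually_mono)
  fix t :: real assume "t > 0"
  have "(\<integral>x. 2 * Z x \<partial>M) \<le> (\<integral>x. t * X x + Y x / t \<partial>M)"
  proof (rule integral_mono_AE)
    show "AE x in M. 2 * Z x \<le> t * X x + Y x / t"
      using AE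
    proof eventually_elim
      case (elim x)
      have "(2 * Z x)\<^sup>2 \<le> 4 * ((t * X x) * (Y x / t))" using elim \<open>t > 0\<close> by (simp add: power_mult_distrib)
      also have "\<dots> \<le> (t * X x + Y x / t)\<^sup>2"
        using zero_le_power2[of "t * X x - Y x / t"] by (simp add: power2_eq_square algebra_simps)
      finally show ?case
        by (rule power2_le_imp_le) (use elim \<open>t > 0\<close> in simp)
    qed
  qed (use assms in auto)
  then show "2 * (\<integral>x. Z x \<partial>M) \<le> t * (\<integral>x. X x \<partial>M) + (\<integral>x. Y x \<partial>M) / t"
    using assms by simp
qed

lemma integrable_scaleR_continuous:
  fixes h :: "real \<Rightarrow> real" and k :: "real \<Rightarrow> 'a::euclidean_space"
  assumes h: "integrable (lebesgue_on {a<..<b}) h" and k: "continuous_on {a..b} k"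
  shows "integrable (lebesgue_on {a<..<b}) (\<lambda>x. h x *\<^sub>R k x)"
proof -
  obtain C where C: "\<And>x. x \<in> {a..b} \<Longrightarrow> norm (k x) \<le> C"
    using compact_imp_bounded[OF compact_continuous_image[OF k compact_Icc]]
    unfolding bounded_pos by blast
  have m: "k \<in> borel_measurable (lebesgue_on {a<..<b})"
    by (intro continuous_imp_measurable_on_sets_lebesgue continuous_on_subset[OF k]) auto
  have "integrable (lebesgue_on {a<..<b}) (\<lambda>x. C * h x)" using h by simp
  then show ?thesis
  proof (rule Bochner_Integration.integrable_bound)
    show "(\<lambda>x. h x *\<^sub>R k x) \<in> borel_measurable (lebesgue_on {a<..<b})"
      using m borel_measurable_integrable[OF h] by measurable
    show "AE x in lebesgue_on {a<..<b}. norm (h x *\<^sub>R k x) \<le> norm (C * h x)"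
    proof (rule AE_I2)
      fix x assume "x \<in> space (lebesgue_on {a<..<b})"
      then have "x \<in> {a..b}" by (simp add: space_restrict_space)
      then have "norm (k x) \<le> C" using C by blast
      then have "norm (k x) \<le> \<bar>C\<bar>" by linarith
      then show "norm (h x *\<^sub>R k x) \<le> norm (C * h x)"
        by (simp add: abs_mult mult.commute[of "\<bar>h x\<bar>"] mult_right_mono)
    qed
  qed
qed

lemmas integrable_mult_continuous = integrable_scaleR_continuous[where 'a = real, unfolded real_scaleR_def]

text \<open>
  Here \<open>u\<close> is \<open>pf'\<close>, so that \<open>N2\<close> and \<open>K\<close> below are \<open>\<parallel>f'\<parallel>\<^sub>p\<^sup>2\<close> and \<open>\<parallel>f\<parallel>\<^sup>2\<close> with weight \<open>1/p\<close>.
\<close>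

locale sl_solution =
  fixes a b :: real and p q w :: "real \<Rightarrow> real" and f u :: "real \<Rightarrow> complex" and z :: complex
  assumes ab: "a < b"
    and int_p: "integrable (lebesgue_on {a<..<b}) (\<lambda>x. 1 / p x)"
    and int_q: "integrable (lebesgue_on {a<..<b}) q"
    and int_w: "integrable (lebesgue_on {a<..<b}) w"
    and p_pos: "AE x in lebesgue_on {a<..<b}. p x > 0"
    and f_AC: "AC_on a b f" and u_AC: "AC_on a b u"
    and f_deriv: "AE x in lebesgue_on {a<..<b}. (f has_vector_derivative u x / of_real (p x)) (at x)"
    and u_deriv: "AE x in lebesgue_on {a<..<b}.
      (u has_vector_derivative of_real (q x) * f x - z * of_real (w x) * f x) (at x)"
begin

section \<open>Identities and pointwise bounds for a solution\<close>

abbreviation "M \<equiv> lebesgue_on {a<..<b}"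

definition F2 where "F2 x = (norm (f x))\<^sup>2"
definition U2 where "U2 x = (norm (u x))\<^sup>2"
definition K where "K = (\<integral>x. F2 x / p x \<partial>M)"
definition N2 where "N2 = (\<integral>x. U2 x / p x \<partial>M)"
text \<open>Twice this bounds all increments of \<open>F2\<close>, whose derivative is
  \<open>2 * Re (u * cnj f) / p\<close>.\<close>

definition J where "J = (\<integral>x. norm (u x) * norm (f x) / p x \<partial>M)"
definition P where "P = (\<integral>x. 1 / p x \<partial>M)"
definition bdry where "bdry = u b * cnj (f b) - u a * cnj (f a)"

lemma cont [continuous_intros]: "continuous_on {a..b} f" "continuous_on {a..b} u"
    "continuous_on {a..b} F2" "continuous_on {a..b} U2"
  using AC_on_imp_continuous_on[OF f_AC] AC_on_imp_continuous_on[OF u_AC]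
  unfolding F2_def U2_def by (auto intro!: continuous_intros)

lemma integrable_over_p:
  assumes "continuous_on {a..b} k" shows "integrable M (\<lambda>x. k x / p x :: real)"
  using integrable_mult_continuous[OF int_p assms] by simp

lemma nonneg: "F2 x \<ge> 0" "U2 x \<ge> 0"
  by (auto simp: F2_def U2_def)

lemma of_real_F2: "complex_of_real (F2 x) = f x * cnj (f x)"
  and of_real_U2: "complex_of_real (U2 x) = u x * cnj (u x)"
  unfolding F2_def U2_def by (simp_all only: complex_norm_square)

lemma P_pos: "P > 0"
proof -
  have "P \<ge> 0" unfolding P_def using p_pos by (intro integral_nonneg_AE) (auto elim: eventually_mono)
  moreover have "P \<noteq> 0"
  proof
    assume "P = 0"
    then have "AE x in M. 1 / p x = 0"
      unfolding P_def using p_pos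
      by (subst (asm) integral_nonneg_eq_0_iff_AE[OF int_p]) (auto elim: eventually_mono)
    with p_pos have "AE x in M. False" by eventually_elim auto
    then have "negligible {x \<in> {a<..<b}. \<not> False}"
      by (subst (asm) AE_lebesgue_on_iff_negligible) auto
    moreover have "{x \<in> {a<..<b}. \<not> False} = {a<..<b}" by auto
    ultimately show False using ab open_not_negligible[of "{a<..<b}"] by auto
  qed
  ultimately show ?thesis by simp
qed

lemma K_nonneg: "K \<ge> 0" and N2_nonneg: "N2 \<ge> 0"
  unfolding K_def N2_def using p_pos nonneg by (auto intro!: integral_nonneg_AE elim!: eventually_mono)

lemma K_pos:
  assumes "\<not> (AE x in M. f x = 0)"
  shows "K > 0"
proof -
  have "K \<noteq> 0"
  proof
    assume "K = 0"
    then have "AE x in M. F2 x / p x = 0"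
      unfolding K_def using p_pos nonneg
      by (subst (asm) integral_nonneg_eq_0_iff_AE[OF integrable_over_p])
        (auto intro!: continuous_intros elim!: eventually_mono)
    with p_pos have "AE x in M. f x = 0" by eventually_elim (auto simp: F2_def)
    then show False using assms by simp
  qed
  then show ?thesis using K_nonneg by simp
qed

text \<open>The function \<open>u * cnj f\<close> has derivative
  \<open>U2 / p + (q - z * w) * F2\<close> almost everywhere, and the fundamental theorem turns its
  integral into the boundary term.\<close>

lemma energy_identity:
  "of_real ((\<integral>x. q x * F2 x \<partial>M) + N2) - z * of_real (\<integral>x. w x * F2 x \<partial>M) = bdry"
proof -
  let ?h = "\<lambda>x. complex_of_real (q x * F2 x + U2 x / p x) - z * of_real (w x * F2 x)"
  have int: "integrable M (\<lambda>x. q x * F2 x)" "integrable M (\<lambda>x. U2 x / p x)" "integrable M (\<lambda>x. w x * F2 x)"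
    using integrable_mult_continuous[OF int_q cont(3)] integrable_mult_continuous[OF int_w cont(3)]
      integrable_over_p[OF cont(4)] by auto
  have "(\<integral>x. ?h x \<partial>M) = u b * cnj (f b) - u a * cnj (f a)"
  proof (rule AC_on_lebesgue_integral)
    show "AC_on a b (\<lambda>x. u x * cnj (f x))" by (intro AC_on_mult AC_on_cnj f_AC u_AC)
    show "integrable M ?h" using int by (simp del: of_real_add of_real_mult of_real_divide)
    show "AE x in M. ((\<lambda>x. u x * cnj (f x)) has_vector_derivative ?h x) (at x)"
      using f_deriv u_deriv
    proof eventually_elim
      case (elim x)
      have "((\<lambda>x. u x * cnj (f x)) has_vector_derivative
        u x * cnj (u x / of_real (p x)) + (of_real (q x) * f x - z * of_real (w x) * f x) * cnj (f x)) (at x)"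
        using elim by (intro has_vector_derivative_mult has_vector_derivative_cnj)
      also have "u x * cnj (u x / of_real (p x)) + (of_real (q x) * f x - z * of_real (w x) * f x) * cnj (f x) = ?h x"
        by (simp add: of_real_F2 of_real_U2 algebra_simps)
      finally show ?case .
    qed
  qed (use ab in simp)
  moreover have "(\<integral>x. ?h x \<partial>M) = of_real ((\<integral>x. q x * F2 x \<partial>M) + N2) - z * of_real (\<integral>x. w x * F2 x \<partial>M)"
    using int by (simp add: N2_def integral_complex_of_real del: of_real_add of_real_mult of_real_divide)
  ultimately show ?thesis by (simp add: bdry_def)
qed

text \<open>The fundamental theorem for \<open>g * u * cnj f\<close>: the boundary terms vanish with
  \<open>g\<close>, and \<open>z\<close> now multiplies an integral with weight
  \<open>g * w\<close>, which can be bounded below when \<open>g * w\<close> is positive.\<close>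

lemma weighted_identity:
  assumes g: "AC_on a b g" "g a = 0" "g b = 0"
    and g_deriv: "AE x in M. (g has_real_derivative g' x) (at x)" and int_g: "integrable M g'"
  shows "of_real ((\<integral>x. g x * (q x * F2 x) \<partial>M) + (\<integral>x. g x * (U2 x / p x) \<partial>M))
    + (\<integral>x. of_real (g' x) * (u x * cnj (f x)) \<partial>M) = z * of_real (\<integral>x. g x * (w x * F2 x) \<partial>M)"
proof -
  let ?h = "\<lambda>x. complex_of_real (g x * (q x * F2 x) + g x * (U2 x / p x)) - z * of_real (g x * (w x * F2 x))
    + of_real (g' x) * (u x * cnj (f x))"
  have gF: "continuous_on {a..b} (\<lambda>x. F2 x * g x)" "continuous_on {a..b} (\<lambda>x. g x * U2 x)"
    "continuous_on {a..b} (\<lambda>x. u x * cnj (f x))"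
    by (intro continuous_intros AC_on_imp_continuous_on[OF g(1)])+
  have int: "integrable M (\<lambda>x. g x * (q x * F2 x))" "integrable M (\<lambda>x. g x * (U2 x / p x))"
    "integrable M (\<lambda>x. g x * (w x * F2 x))" "integrable M (\<lambda>x. of_real (g' x) * (u x * cnj (f x)))"
    using integrable_mult_continuous[OF int_q gF(1)] integrable_mult_continuous[OF int_w gF(1)]
      integrable_over_p[OF gF(2)] integrable_scaleR_continuous[OF int_g gF(3)]
    by (simp_all add: mult_ac scaleR_conv_of_real)
  have "(\<integral>x. ?h x \<partial>M) = of_real (g b) * (u b * cnj (f b)) - of_real (g a) * (u a * cnj (f a))"
  proof (rule AC_on_lebesgue_integral)
    show "AC_on a b (\<lambda>x. of_real (g x) * (u x * cnj (f x)))"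
      by (intro AC_on_mult AC_on_cnj AC_on_of_real f_AC u_AC g)
    show "integrable M ?h" using int by (simp del: of_real_add of_real_mult of_real_divide times_divide_eq_right)
    show "AE x in M. ((\<lambda>x. of_real (g x) * (u x * cnj (f x))) has_vector_derivative ?h x) (at x)"
      using f_deriv u_deriv g_deriv
    proof eventually_elim
      case (elim x)
      have "((\<lambda>x. complex_of_real (g x) * (u x * cnj (f x))) has_vector_derivative
        of_real (g x) * (u x * cnj (u x / of_real (p x)) + (of_real (q x) * f x - z * of_real (w x) * f x) * cnj (f x))
         + of_real (g' x) * (u x * cnj (f x))) (at x)"
        using elim by (intro has_vector_derivative_mult has_vector_derivative_cnj has_vector_derivative_of_real)
          (auto simp: has_real_derivative_iff_has_vector_derivative)
      also have "of_real (g x) * (u x * cnj (u x / of_real (p x)) + (of_real (q x) * f x - z * of_real (w x) * f x) * cnj (f x))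
         + of_real (g' x) * (u x * cnj (f x)) = ?h x"
        by (simp add: of_real_F2 of_real_U2 algebra_simps)
      finally show ?case .
    qed
  qed (use ab in simp)
  moreover have "(\<integral>x. ?h x \<partial>M) = of_real ((\<integral>x. g x * (q x * F2 x) \<partial>M) + (\<integral>x. g x * (U2 x / p x) \<partial>M))
    - z * of_real (\<integral>x. g x * (w x * F2 x) \<partial>M) + (\<integral>x. of_real (g' x) * (u x * cnj (f x)) \<partial>M)"
    using int by (simp add: integral_complex_of_real del: of_real_add of_real_mult of_real_divide times_divide_eq_right)
  ultimately show ?thesis using g by (simp add: algebra_simps)
qed

lemma J_le: "J \<le> sqrt N2 * sqrt K"
  unfolding J_def N2_def K_def
proof (rule integral_Cauchy_Schwarz)
  show "AE x in M. 0 \<le> U2 x / p x \<and> 0 \<le> F2 x / p x \<and>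
       (norm (u x) * norm (f x) / p x)\<^sup>2 \<le> U2 x / p x * (F2 x / p x)"
    using p_pos by eventually_elim (simp add: F2_def U2_def power_divide power_mult_distrib power2_eq_square mult_ac)
qed (auto intro!: integrable_over_p continuous_intros)

lemma F2_increment_le:
  assumes "x \<in> {a..b}" "y \<in> {a..b}"
  shows "F2 x - F2 y \<le> 2 * J"
proof -
  \<comment> \<open>The absolute value of \<open>1 / p\<close> makes \<open>k\<close> dominate
    \<open>h\<close> at every point, as the comparison of gauge integrals below demands, although
    \<open>p > 0\<close> holds only almost everywhere.\<close>
  define k where "k x = 2 * (norm (u x) * norm (f x)) * \<bar>1 / p x\<bar>" for x
  define h where "h x = 2 * Re (u x * cnj (f x)) / p x" for x
  have "integrable M (\<lambda>x. \<bar>1 / p x\<bar> * (2 * (norm (u x) * norm (f x))))"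
    by (intro integrable_mult_continuous integrable_abs int_p continuous_intros)
  also have "(\<lambda>x. \<bar>1 / p x\<bar> * (2 * (norm (u x) * norm (f x)))) = k"
    by (auto simp: k_def)
  finally have int_k: "integrable M k" .
  have k0: "k x \<ge> 0" for x by (simp add: k_def)
  have hk: "norm (h x) \<le> k x" for x
  proof -
    have "\<bar>Re (u x * cnj (f x))\<bar> \<le> norm (u x) * norm (f x)"
      using abs_Re_le_cmod[of "u x * cnj (f x)"] by (simp add: norm_mult)
    then show ?thesis by (simp add: h_def k_def abs_mult divide_right_mono)
  qed
  have "(k has_integral (\<integral>x. k x \<partial>M)) {a<..<b}"
    using int_k by (intro has_integral_integral_lebesgue_on) auto
  then have k: "(k has_integral (\<integral>x. k x \<partial>M)) {a..b}" by (simp add: has_integral_Icc_iff_Ioo)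
  have kJ: "(\<integral>x. k x \<partial>M) = 2 * J"
  proof -
    have "(\<integral>x. k x \<partial>M) = (\<integral>x. 2 * (norm (u x) * norm (f x) / p x) \<partial>M)"
    proof (rule integral_cong_AE)
      show "k \<in> borel_measurable M" using int_k by (rule borel_measurable_integrable)
      show "(\<lambda>x. 2 * (norm (u x) * norm (f x) / p x)) \<in> borel_measurable M"
        by (intro borel_measurable_integrable integrable_mult_right integrable_over_p continuous_intros)
      show "AE x in M. k x = 2 * (norm (u x) * norm (f x) / p x)"
        using p_pos by eventually_elim (simp add: k_def)
    qed
    then show ?thesis by (simp add: J_def del: times_divide_eq_right)
  qed
  have F2_deriv: "AE x in M. (F2 has_vector_derivative h x) (at x)"
    using f_deriv
  proof eventually_elim
    case (elim x)
    have "((\<lambda>x. f x * cnj (f x)) has_vector_derivative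
      f x * cnj (u x / of_real (p x)) + u x / of_real (p x) * cnj (f x)) (at x)"
      using elim by (intro has_vector_derivative_mult has_vector_derivative_cnj)
    then have "((\<lambda>x. Re (f x * cnj (f x))) has_vector_derivative
      Re (f x * cnj (u x / of_real (p x)) + u x / of_real (p x) * cnj (f x))) (at x)"
      by (simp add: has_vector_derivative_complex_iff has_real_derivative_iff_has_vector_derivative)
    moreover have "Re (f x * cnj (u x / of_real (p x)) + u x / of_real (p x) * cnj (f x)) = h x"
      by (simp add: h_def add_divide_distrib mult.commute)
    moreover have "(\<lambda>x. Re (f x * cnj (f x))) = F2"
      by (simp flip: of_real_F2)
    ultimately show ?case by simp
  qed
  have F2_AC: "AC_on a b F2"
  proof -
    have "AC_on a b (\<lambda>x. Re (f x * cnj (f x)))"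
      by (rule AC_on_nonexpansive[OF AC_on_mult[OF f_AC AC_on_cnj[OF f_AC]]])
        (metis abs_Re_le_cmod minus_complex.sel(1) real_norm_def)
    moreover have "(\<lambda>x. Re (f x * cnj (f x))) = F2"
      by (simp flip: of_real_F2)
    ultimately show ?thesis by simp
  qed
  have main: "\<bar>F2 d - F2 c\<bar> \<le> 2 * J" if cd: "a \<le> c" "c \<le> d" "d \<le> b" for c d
  proof -
    have h: "(h has_integral F2 d - F2 c) {c..d}"
    proof (rule AC_on_has_integral[OF AC_on_subinterval[OF F2_AC]])
      show "negligible {x \<in> {a<..<b}. \<not> (F2 has_vector_derivative h x) (at x)}"
        using F2_deriv by (simp add: AE_lebesgue_on_iff_negligible)
    qed (use cd in auto)
    have k_ab: "k integrable_on {a..b}" using k by (rule has_integral_integrable)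
    then have k_cd: "k integrable_on {c..d}"
      by (rule integrable_on_subinterval) (use cd in simp)
    have "norm (F2 d - F2 c) = norm (integral {c..d} h)" using h by (simp add: integral_unique)
    also have "\<dots> \<le> integral {c..d} k"
      by (rule integral_norm_bound_integral[OF has_integral_integrable[OF h] k_cd hk])
    also have "\<dots> \<le> integral {a..b} k"
      by (rule integral_subset_le[OF _ k_cd k_ab]) (use cd k0 in auto)
    also have "\<dots> = 2 * J" using k kJ by (simp add: integral_unique)
    finally show ?thesis by simp
  qed
  show ?thesis using main[of x y] main[of y x] assms by (cases "x \<le> y") auto
qed

lemma F2_le:
  assumes x: "x \<in> {a..b}"
  shows "F2 x \<le> 2 * J + K / P"
proof -
  have "F2 x * P = (\<integral>y. F2 x * (1 / p y) \<partial>M)"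
    unfolding P_def by (rule integral_mult_right_zero[symmetric])
  also have "\<dots> \<le> (\<integral>y. F2 y / p y + 2 * J * (1 / p y) \<partial>M)"
  proof (rule integral_mono_AE)
    show "AE y in M. F2 x * (1 / p y) \<le> F2 y / p y + 2 * J * (1 / p y)"
      using p_pos AE_space
    proof eventually_elim
      case (elim y)
      then have "F2 x \<le> F2 y + 2 * J" using F2_increment_le[OF x, of y] by (simp add: space_restrict_space)
      then show ?case using elim by (simp add: field_simps)
    qed
  qed (intro Bochner_Integration.integrable_add integrable_mult_right int_p integrable_over_p[OF cont(3)])+
  also have "\<dots> = K + 2 * J * P"
    using int_p integrable_over_p[OF cont(3)] by (simp add: K_def P_def del: times_divide_eq_right)
  finally show ?thesis using P_pos by (simp add: field_simps)
qed

end

section \<open>Norm estimates for the solution and the resulting eigenvalue bounds\<close>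

lemma le_of_quadratic_le:
  fixes n k \<alpha> s :: real
  assumes "k \<ge> 0" "\<alpha> \<ge> 0" "s \<ge> 0" and le: "n\<^sup>2 \<le> \<alpha> * (2 * n * k + k\<^sup>2 * s)"
  shows "n \<le> (sqrt (\<alpha> * (s + \<alpha>)) + \<alpha>) * k"
proof -
  \<comment> \<open>Completing the square. The coefficient of \<open>k\<close> in the claim is the
    larger root of the quadratic for \<open>k = 1\<close>; this is the origin of \<beta>.\<close>
  have "(n - \<alpha> * k)\<^sup>2 \<le> k\<^sup>2 * (\<alpha> * (s + \<alpha>))"
    using le by (simp add: power2_eq_square algebra_simps)
  then have "n - \<alpha> * k \<le> sqrt (k\<^sup>2 * (\<alpha> * (s + \<alpha>)))" by (rule real_le_rsqrt)
  also have "\<dots> = k * sqrt (\<alpha> * (s + \<alpha>))" using assms by (simp add: real_sqrt_mult)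
  finally show ?thesis by (simp add: algebra_simps)
qed

context sl_solution
begin

lemma integral_w_zero:
  assumes "Im bdry = 0" "Im z \<noteq> 0"
  shows "(\<integral>x. w x * F2 x \<partial>M) = 0"
  using arg_cong[OF energy_identity, of Im] assms by simp

text \<open>In the real part of the energy identity the \<open>w\<close> term drops out, so
  \<open>N2\<close> is \<open>Re bdry\<close> minus the integral of \<open>q * F2\<close>; only the
  negative part of \<open>q\<close> can make that integral enlarge \<open>N2\<close>.\<close>

lemma N2_le:
  assumes "Im bdry = 0" "Im z \<noteq> 0" and m: "\<And>x. x \<in> {a..b} \<Longrightarrow> F2 x \<le> m" and "Re bdry \<le> c * m"
  shows "N2 \<le> (c + (\<integral>x. \<bar>min 0 (q x)\<bar> \<partial>M)) * m"
proof -
  have int_min: "integrable M (\<lambda>x. \<bar>min 0 (q x)\<bar>)"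
    using int_q by (intro integrable_abs integrable_min) auto
  have "(\<integral>x. q x * F2 x \<partial>M) + N2 = Re bdry"
    using arg_cong[OF energy_identity, of Re] integral_w_zero[OF assms(1,2)] by simp
  moreover have "(\<integral>x. - (q x * F2 x) \<partial>M) \<le> (\<integral>x. m * \<bar>min 0 (q x)\<bar> \<partial>M)"
  proof (rule integral_mono_AE)
    show "AE x in M. - (q x * F2 x) \<le> m * \<bar>min 0 (q x)\<bar>"
    proof (rule AE_I2)
      fix x assume "x \<in> space M"
      then have "F2 x \<le> m" by (intro m) (simp add: space_restrict_space)
      have "- (q x * F2 x) \<le> \<bar>min 0 (q x)\<bar> * F2 x"
        using nonneg(1)[of x] by (auto simp: min_def mult_nonneg_nonneg)
      also have "\<dots> \<le> \<bar>min 0 (q x)\<bar> * m" using \<open>F2 x \<le> m\<close> by (intro mult_left_mono) auto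
      finally show "- (q x * F2 x) \<le> m * \<bar>min 0 (q x)\<bar>" by (simp add: mult.commute)
    qed
  qed (use int_min integrable_mult_continuous[OF int_q cont(3)] in auto)
  ultimately show ?thesis using assms(4) by (simp add: algebra_simps)
qed

text \<open>The sup bound \<open>m\<close> is linear in \<open>sqrt N2\<close>, so
  \<open>N2 \<le> \<alpha> * m\<close> is a quadratic inequality for \<open>sqrt N2\<close>; putting
  its solution back into \<open>m\<close> gives the factor that becomes
  \<open>\<gamma>\<^sup>2\<close>. The boundary hypothesis ranges over all \<open>m\<close> so that
  this bound can be inserted.\<close>

lemma growth_estimates:
  assumes bd: "Im bdry = 0"
      "\<forall>m. (norm (f a))\<^sup>2 \<le> m \<longrightarrow> (norm (f b))\<^sup>2 \<le> m \<longrightarrow> Re bdry \<le> c * m"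
    and z: "Im z \<noteq> 0" and "c \<ge> 0"
    and \<alpha>: "\<alpha> = c + (\<integral>x. \<bar>min 0 (q x)\<bar> \<partial>M)"
    and \<beta>: "\<beta> = sqrt (\<alpha> * (1 / P + \<alpha>)) + \<alpha>"
  shows "sqrt N2 \<le> \<beta> * sqrt K" "x \<in> {a..b} \<Longrightarrow> F2 x \<le> (2 * \<beta> + 1 / P) * K"
proof -
  define m where "m = 2 * (sqrt N2 * sqrt K) + K / P"
  have m: "F2 x \<le> m" if "x \<in> {a..b}" for x
    using F2_le[OF that] J_le by (simp add: m_def)
  have Re_bdry: "Re bdry \<le> c * m"
    using m[of a] m[of b] ab by (intro bd(2)[rule_format]) (auto simp: F2_def)
  have "N2 \<le> \<alpha> * m" unfolding \<alpha> by (rule N2_le[OF bd(1) z m Re_bdry])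
  moreover have "0 \<le> \<alpha>" unfolding \<alpha> using \<open>c \<ge> 0\<close> by (intro add_nonneg_nonneg Bochner_Integration.integral_nonneg) auto
  ultimately show N: "sqrt N2 \<le> \<beta> * sqrt K"
    unfolding \<beta> using P_pos K_nonneg N2_nonneg
    by (intro le_of_quadratic_le) (auto simp: m_def algebra_simps)
  assume "x \<in> {a..b}"
  then have "F2 x \<le> m" by (rule m)
  also have "sqrt N2 * sqrt K \<le> (\<beta> * sqrt K) * sqrt K"
    using N K_nonneg by (intro mult_right_mono) auto
  then have "m \<le> (2 * \<beta> + 1 / P) * K"
    using K_nonneg by (simp add: m_def mult.assoc distrib_right)
  finally show "F2 x \<le> (2 * \<beta> + 1 / P) * K" .
qed

text \<open>Off the small set \<open>g * w * F2\<close> is at least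
  \<open>\<epsilon> * F2 / p\<close>. On it the sup bound limits the missing part to
  \<open>\<epsilon> * \<gamma>\<^sup>2 * K\<close> times its measure, which is at most half of
  \<open>\<epsilon> * K\<close>.\<close>

lemma weighted_mass_ge:
  assumes g: "continuous_on {a..b} g" and gw: "AE x in M. g x * w x > 0" and "\<epsilon> > 0" "\<gamma> > 0"
    and S: "(\<integral>x. indicator {x \<in> {a<..<b}. p x * g x * w x < \<epsilon>} x / p x \<partial>M) \<le> 1 / (2 * \<gamma>\<^sup>2)"
    and meas: "{x \<in> {a<..<b}. p x * g x * w x < \<epsilon>} \<in> sets M"
    and F2: "\<forall>x\<in>{a..b}. F2 x \<le> \<gamma>\<^sup>2 * K"
  shows "\<epsilon> * K / 2 \<le> (\<integral>x. g x * (w x * F2 x) \<partial>M)"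
proof -
  let ?S = "{x \<in> {a<..<b}. p x * g x * w x < \<epsilon>}"
  have int_S: "integrable M (\<lambda>x. indicator ?S x / p x :: real)"
    using integrable_mult_indicator[OF meas int_p] by simp
  have int_F: "integrable M (\<lambda>x. \<epsilon> * (F2 x / p x))"
    by (intro integrable_mult_right integrable_over_p cont)
  have "continuous_on {a..b} (\<lambda>x. F2 x * g x)" by (intro continuous_intros g)
  from integrable_mult_continuous[OF int_w this]
  have int_w': "integrable M (\<lambda>x. g x * (w x * F2 x))" by (simp add: mult_ac)
  have "(\<integral>x. \<epsilon> * (F2 x / p x) - \<epsilon> * (\<gamma>\<^sup>2 * K) * (indicator ?S x / p x) \<partial>M) \<le> (\<integral>x. g x * (w x * F2 x) \<partial>M)"
  proof (rule integral_mono_AE)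
    show "AE x in M. \<epsilon> * (F2 x / p x) - \<epsilon> * (\<gamma>\<^sup>2 * K) * (indicator ?S x / p x) \<le> g x * (w x * F2 x)"
      using p_pos gw AE_space
    proof eventually_elim
      case (elim x)
      then have x: "x \<in> {a<..<b}" by (simp add: space_restrict_space)
      have pos: "0 \<le> g x * w x * F2 x" using elim nonneg by (simp add: less_imp_le)
      show ?case
      proof (cases "x \<in> ?S")
        case True
        \<comment> \<open>On the small set the subtracted term makes the left side nonpositive,
          while the right side is nonnegative.\<close>
        have "\<epsilon> * (F2 x / p x) \<le> \<epsilon> * ((\<gamma>\<^sup>2 * K) / p x)"
          using \<open>\<epsilon> > 0\<close> elim(1) F2 x by (intro mult_left_mono divide_right_mono) auto
        then show ?thesis using True pos by (simp add: mult.assoc)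
      next
        case False
        then have "\<epsilon> / p x \<le> g x * w x" using x elim(1) by (simp add: field_simps)
        then have "\<epsilon> / p x * F2 x \<le> g x * w x * F2 x" using nonneg by (intro mult_right_mono) auto
        then show ?thesis using False by (simp add: mult.assoc)
      qed
    qed
  qed (intro Bochner_Integration.integrable_diff integrable_mult_right int_F int_S int_w')+
  also have "(\<integral>x. \<epsilon> * (F2 x / p x) - \<epsilon> * (\<gamma>\<^sup>2 * K) * (indicator ?S x / p x) \<partial>M)
    = \<epsilon> * K - \<epsilon> * (\<gamma>\<^sup>2 * K) * (\<integral>x. indicator ?S x / p x \<partial>M)"
    using int_F int_S integrable_over_p[OF cont(3)] by (simp add: K_def del: times_divide_eq_right)
  finally have 1: "\<epsilon> * K - \<epsilon> * (\<gamma>\<^sup>2 * K) * (\<integral>x. indicator ?S x / p x \<partial>M) \<le> (\<integral>x. g x * (w x * F2 x) \<partial>M)" .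
  have "\<epsilon> * (\<gamma>\<^sup>2 * K) * (\<integral>x. indicator ?S x / p x \<partial>M) \<le> \<epsilon> * (\<gamma>\<^sup>2 * K) * (1 / (2 * \<gamma>\<^sup>2))"
    using S \<open>\<epsilon> > 0\<close> K_nonneg by (intro mult_left_mono) auto
  also have "\<dots> = \<epsilon> * K / 2" using \<open>\<gamma> > 0\<close> by (simp add: field_simps)
  finally show ?thesis using 1 by simp
qed

text \<open>The weighted identity reads \<open>R + T = z * m\<close> with \<open>R\<close> real, so
  \<open>Im z\<close> is governed by \<open>T\<close> alone. Both \<open>R\<close> and
  \<open>T\<close> are bounded by multiples of \<open>K\<close>, and the lower bound on
  \<open>m\<close> permits the division.\<close>

lemma eigenvalue_bounds:
  assumes nz: "\<not> (AE x in M. f x = 0)"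
    and N: "sqrt N2 \<le> \<beta> * sqrt K" and F2: "\<forall>x\<in>{a..b}. F2 x \<le> \<gamma>\<^sup>2 * K" and "\<gamma> > 0"
    and g: "AC_on a b g" "g a = 0" "g b = 0"
    and g_deriv: "AE x in M. (g has_real_derivative g' x) (at x)"
    and g'_meas: "g' \<in> borel_measurable M"
    and int_g: "integrable M (\<lambda>x. p x * (g' x)\<^sup>2)"
    and mass: "\<epsilon> * K / 2 \<le> (\<integral>x. g x * (w x * F2 x) \<partial>M)" and "\<epsilon> > 0"
    and L: "AE x in M. \<bar>g x\<bar> \<le> L"
  defines "G \<equiv> sqrt (\<integral>x. p x * (g' x)\<^sup>2 \<partial>M)"
  shows "\<bar>Im z\<bar> \<le> 2 / \<epsilon> * \<beta> * \<gamma> * G"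
    and "\<bar>Re z\<bar> \<le> 2 / \<epsilon> * (\<beta> * \<gamma> * G + (\<beta>\<^sup>2 + \<gamma>\<^sup>2 * (\<integral>x. \<bar>q x\<bar> \<partial>M)) * L)"
proof -
  have "K > 0" using K_pos[OF nz] .
  \<comment> \<open>A negative \<open>L\<close> would make its almost everywhere bound absurd, so
    that every such statement, including \<open>f x = 0\<close>, would follow.\<close>
  have "L \<ge> 0"
  proof (rule ccontr)
    assume "\<not> L \<ge> 0"
    from L have "AE x in M. f x = 0" by eventually_elim (use \<open>\<not> L \<ge> 0\<close> in linarith)
    then show False using nz by simp
  qed
  \<comment> \<open>By AM-GM, finite energy with weight \<open>p\<close> together with integrability
    of \<open>1 / p\<close> gives an integrable majorant of \<open>g'\<close>.\<close>
  have int_g': "integrable M g'"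
  proof (rule Bochner_Integration.integrable_bound)
    show "integrable M (\<lambda>x. 1 / p x + p x * (g' x)\<^sup>2)" using int_p int_g by simp
    show "AE x in M. norm (g' x) \<le> norm (1 / p x + p x * (g' x)\<^sup>2)"
      using p_pos
    proof eventually_elim
      case (elim x)
      have "0 \<le> (1 - p x * \<bar>g' x\<bar>)\<^sup>2" by simp
      then have "2 * (p x * \<bar>g' x\<bar>) \<le> 1 + p x * (p x * (g' x)\<^sup>2)"
        by (simp add: power2_eq_square algebra_simps)
      moreover have "0 \<le> p x * \<bar>g' x\<bar>" using elim by simp
      ultimately have "p x * \<bar>g' x\<bar> \<le> 1 + p x * (p x * (g' x)\<^sup>2)" by linarith
      then have "\<bar>g' x\<bar> \<le> 1 / p x + p x * (g' x)\<^sup>2" using elim by (simp add: field_simps)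
      then show ?case by simp
    qed
  qed fact
  define T where "T = (\<integral>x. of_real (g' x) * (u x * cnj (f x)) \<partial>M)"
  define m where "m = (\<integral>x. g x * (w x * F2 x) \<partial>M)"
  define R where "R = (\<integral>x. g x * (q x * F2 x) \<partial>M) + (\<integral>x. g x * (U2 x / p x) \<partial>M)"
  have id: "of_real R + T = z * of_real m"
    unfolding R_def T_def m_def by (rule weighted_identity[OF g g_deriv int_g'])
  have f_le: "norm (f x) \<le> \<gamma> * sqrt K" if "x \<in> {a..b}" for x
    using real_sqrt_le_mono[OF F2[rule_format, OF that]] \<open>\<gamma> > 0\<close> by (simp add: F2_def real_sqrt_mult)
  have int_gu: "integrable M (\<lambda>x. \<bar>g' x\<bar> * norm (u x))"
    by (intro integrable_mult_continuous integrable_abs int_g' continuous_intros)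
  \<comment> \<open>The sup bound takes \<open>f\<close> out of the integral; Cauchy-Schwarz then
    splits \<open>g' * u\<close> into \<open>sqrt p * g'\<close> and
    \<open>u / sqrt p\<close>.\<close>
  have T: "norm T \<le> \<gamma> * \<beta> * G * K"
  proof -
    have "continuous_on {a..b} (\<lambda>x. u x * cnj (f x))" by (intro continuous_intros)
    from integrable_scaleR_continuous[OF int_g' this]
    have int_T: "integrable M (\<lambda>x. of_real (g' x) * (u x * cnj (f x)))"
      by (simp add: scaleR_conv_of_real)
    have "norm T \<le> (\<integral>x. norm (of_real (g' x) * (u x * cnj (f x))) \<partial>M)"
      unfolding T_def by (rule integral_norm_bound)
    also have "\<dots> \<le> (\<integral>x. (\<gamma> * sqrt K) * (\<bar>g' x\<bar> * norm (u x)) \<partial>M)"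
    proof (rule integral_mono_AE)
      show "AE x in M. norm (of_real (g' x) * (u x * cnj (f x))) \<le> (\<gamma> * sqrt K) * (\<bar>g' x\<bar> * norm (u x))"
      proof (rule AE_I2)
        fix x assume "x \<in> space M"
        then have "norm (f x) \<le> \<gamma> * sqrt K" by (intro f_le) (simp add: space_restrict_space)
        then have "(\<bar>g' x\<bar> * norm (u x)) * norm (f x) \<le> (\<bar>g' x\<bar> * norm (u x)) * (\<gamma> * sqrt K)"
          by (intro mult_left_mono) auto
        then show "norm (of_real (g' x) * (u x * cnj (f x))) \<le> (\<gamma> * sqrt K) * (\<bar>g' x\<bar> * norm (u x))"
          by (simp add: norm_mult mult_ac)
      qed
    qed (use int_T int_gu in auto)
    also have "\<dots> = (\<gamma> * sqrt K) * (\<integral>x. \<bar>g' x\<bar> * norm (u x) \<partial>M)" by simp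
    also have "(\<integral>x. \<bar>g' x\<bar> * norm (u x) \<partial>M) \<le> G * sqrt N2"
      unfolding G_def N2_def
    proof (rule integral_Cauchy_Schwarz)
      show "AE x in M. 0 \<le> p x * (g' x)\<^sup>2 \<and> 0 \<le> U2 x / p x \<and>
          (\<bar>g' x\<bar> * norm (u x))\<^sup>2 \<le> p x * (g' x)\<^sup>2 * (U2 x / p x)"
        using p_pos by eventually_elim (simp add: U2_def power_mult_distrib)
    qed (use int_g int_gu integrable_over_p[OF cont(4)] in auto)
    also have "G * sqrt N2 \<le> G * (\<beta> * sqrt K)"
      unfolding G_def using N p_pos
      by (intro mult_left_mono real_sqrt_ge_zero integral_nonneg_AE) (auto elim!: eventually_mono)
    also have "(\<gamma> * sqrt K) * (G * (\<beta> * sqrt K)) = \<gamma> * \<beta> * G * K"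
      using \<open>K > 0\<close> by simp
    finally show ?thesis using \<open>\<gamma> > 0\<close> \<open>K > 0\<close> by (simp add: mult_left_mono)
  qed
  have R: "\<bar>R\<bar> \<le> (\<beta>\<^sup>2 + \<gamma>\<^sup>2 * (\<integral>x. \<bar>q x\<bar> \<partial>M)) * L * K"
  proof -
    have gF: "continuous_on {a..b} (\<lambda>x. F2 x * g x)" "continuous_on {a..b} (\<lambda>x. g x * U2 x)"
      by (intro continuous_intros AC_on_imp_continuous_on[OF g(1)])+
    have int: "integrable M (\<lambda>x. g x * (q x * F2 x))" "integrable M (\<lambda>x. g x * (U2 x / p x))"
      using integrable_mult_continuous[OF int_q gF(1)] integrable_over_p[OF gF(2)]
      by (simp_all add: mult_ac)
    have "\<bar>\<integral>x. g x * (q x * F2 x) \<partial>M\<bar> \<le> (\<integral>x. norm (g x * (q x * F2 x)) \<partial>M)"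
      using integral_norm_bound[of M "\<lambda>x. g x * (q x * F2 x)"] by simp
    also have "\<dots> \<le> (\<integral>x. L * (\<gamma>\<^sup>2 * K) * \<bar>q x\<bar> \<partial>M)"
    proof (rule integral_mono_AE)
      show "AE x in M. norm (g x * (q x * F2 x)) \<le> L * (\<gamma>\<^sup>2 * K) * \<bar>q x\<bar>"
        using L AE_space
      proof eventually_elim
        case (elim x)
        then have "F2 x \<le> \<gamma>\<^sup>2 * K" by (intro F2[rule_format]) (simp add: space_restrict_space)
        then have "\<bar>g x\<bar> * F2 x * \<bar>q x\<bar> \<le> L * (\<gamma>\<^sup>2 * K) * \<bar>q x\<bar>"
          using elim \<open>L \<ge> 0\<close> nonneg K_nonneg by (intro mult_mono) auto
        then show ?case using nonneg(1)[of x] by (simp add: abs_mult mult_ac)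
      qed
    qed (use int int_q in auto)
    also have "\<dots> = L * (\<gamma>\<^sup>2 * K) * (\<integral>x. \<bar>q x\<bar> \<partial>M)" by simp
    finally have 1: "\<bar>\<integral>x. g x * (q x * F2 x) \<partial>M\<bar> \<le> L * (\<gamma>\<^sup>2 * K) * (\<integral>x. \<bar>q x\<bar> \<partial>M)" .
    have "\<bar>\<integral>x. g x * (U2 x / p x) \<partial>M\<bar> \<le> (\<integral>x. norm (g x * (U2 x / p x)) \<partial>M)"
      using integral_norm_bound[of M "\<lambda>x. g x * (U2 x / p x)"] by simp
    also have "\<dots> \<le> (\<integral>x. L * (U2 x / p x) \<partial>M)"
    proof (rule integral_mono_AE)
      show "AE x in M. norm (g x * (U2 x / p x)) \<le> L * (U2 x / p x)"
        using L p_pos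
      proof eventually_elim
        case (elim x)
        then have "\<bar>g x\<bar> * (U2 x / p x) \<le> L * (U2 x / p x)"
          using nonneg by (intro mult_right_mono) auto
        then show ?case using nonneg(2)[of x] elim by (simp add: abs_mult)
      qed
    qed (intro integrable_norm int integrable_mult_right integrable_over_p cont)+
    also have "\<dots> = L * N2" unfolding N2_def by (rule integral_mult_right_zero)
    also have "N2 \<le> (\<beta> * sqrt K)\<^sup>2" using power_mono[OF N, of 2] N2_nonneg by simp
    also have "(\<beta> * sqrt K)\<^sup>2 = \<beta>\<^sup>2 * K" using \<open>K > 0\<close> by (simp add: power_mult_distrib)
    finally have 2: "\<bar>\<integral>x. g x * (U2 x / p x) \<partial>M\<bar> \<le> L * (\<beta>\<^sup>2 * K)" using \<open>L \<ge> 0\<close> by (simp add: mult_left_mono)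
    show ?thesis using 1 2 unfolding R_def by (simp add: algebra_simps)
  qed
  \<comment> \<open>Common last step of both bounds: replace \<open>m\<close> by its lower bound and
    cancel \<open>K\<close>, which is positive because \<open>f\<close> is not null.\<close>
  have bound: "t \<le> 2 / \<epsilon> * B" if "t * m \<le> B * K" "t \<ge> 0" for t B
  proof -
    have "t * (\<epsilon> * K / 2) \<le> t * m" using that(2) mass unfolding m_def by (rule mult_left_mono[rotated])
    then have "t * (\<epsilon> * K / 2) \<le> B * K" using that(1) by (rule order_trans)
    then have "t * \<epsilon> / 2 \<le> B" using \<open>K > 0\<close> by (simp add: field_simps)
    then show ?thesis using \<open>\<epsilon> > 0\<close> by (simp add: field_simps)
  qed
  have "0 \<le> \<epsilon> * K / 2" using \<open>K > 0\<close> \<open>\<epsilon> > 0\<close> by simp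
  then have "m \<ge> 0" using mass unfolding m_def by (rule order_trans)
  have "Im T = Im z * m" "R + Re T = Re z * m"
    using arg_cong[OF id, of Im] arg_cong[OF id, of Re] by simp_all
  then have "\<bar>Im z\<bar> * m = \<bar>Im T\<bar>" "\<bar>Re z\<bar> * m = \<bar>R + Re T\<bar>"
    using \<open>m \<ge> 0\<close> by (simp_all add: abs_mult)
  then have "\<bar>Im z\<bar> * m \<le> (\<beta> * \<gamma> * G) * K"
    "\<bar>Re z\<bar> * m \<le> (\<beta> * \<gamma> * G + (\<beta>\<^sup>2 + \<gamma>\<^sup>2 * (\<integral>x. \<bar>q x\<bar> \<partial>M)) * L) * K"
    using T R abs_Im_le_cmod[of T] abs_Re_le_cmod[of T] by (simp_all add: algebra_simps)
  from bound[OF this(1)] bound[OF this(2)]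
  show "\<bar>Im z\<bar> \<le> 2 / \<epsilon> * \<beta> * \<gamma> * G"
    and "\<bar>Re z\<bar> \<le> 2 / \<epsilon> * (\<beta> * \<gamma> * G + (\<beta>\<^sup>2 + \<gamma>\<^sup>2 * (\<integral>x. \<bar>q x\<bar> \<partial>M)) * L)"
    by (simp_all add: mult.assoc)
qed

end

section \<open>Selfadjoint boundary conditions\<close>

text \<open>A Robin condition turns the product into the real number
  \<open>k * (norm y)\<^sup>2\<close>, a Dirichlet condition into 0. The \<open>case\<close> value
  is what the endpoint contributes to \<open>sa_const\<close>.\<close>

lemma satisfies_bparam_form:
  assumes "satisfies_bparam l y y1" "(norm y)\<^sup>2 \<le> m"
  shows "Im (y1 * cnj y) = 0"
    and "\<bar>Re (y1 * cnj y)\<bar> \<le> (case l of Robin k \<Rightarrow> \<bar>k\<bar> | Dirichlet \<Rightarrow> 0) * m"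
proof -
  have "y1 * cnj y = of_real (k * (norm y)\<^sup>2)" if "l = Robin k" for k
    using assms that by (simp only: of_real_mult complex_norm_square) simp
  then show "Im (y1 * cnj y) = 0"
    "\<bar>Re (y1 * cnj y)\<bar> \<le> (case l of Robin k \<Rightarrow> \<bar>k\<bar> | Dirichlet \<Rightarrow> 0) * m"
    using assms by (cases l; auto simp: abs_mult intro: mult_left_mono simp del: of_real_mult of_real_power)+
qed

text \<open>The phase \<open>e\<close> cancels, and determinant 1 kills the imaginary part. Only
  \<open>y\<close> and \<open>v\<close> are bounded, not \<open>y1\<close>: for
  \<open>r12 = 0\<close> the \<open>y1\<close> term has the factor \<open>r11 * r22 - 1 = 0\<close>;
  otherwise \<open>y1\<close> is eliminated through \<open>v' = r11 * y + r12 * y1\<close>, leaving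
  two squares and a mixed product.\<close>

lemma coupled_form:
  fixes y y1 v v1 e :: complex and r11 r12 r21 r22 :: real
  assumes v: "v = e * (r11 * y + r12 * y1)" "v1 = e * (r21 * y + r22 * y1)" and "norm e = 1"
    and det: "r11 * r22 - r12 * r21 = 1"
    and m: "(norm y)\<^sup>2 \<le> m" "(norm v)\<^sup>2 \<le> m"
  shows "Im (v1 * cnj v - y1 * cnj y) = 0"
    and "Re (v1 * cnj v - y1 * cnj y) \<le>
      (if r12 \<noteq> 0 then (\<bar>r11\<bar> + \<bar>r22\<bar> + 2) / \<bar>r12\<bar> else \<bar>r11 * r21\<bar>) * m"
proof -
  define v' where "v' = r11 * y + r12 * y1"
  have "e * cnj e = 1" using complex_norm_square[of e] \<open>norm e = 1\<close> by simp
  have "v1 * cnj v = (e * cnj e) * ((r21 * y + r22 * y1) * cnj v')"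
    by (simp add: v v'_def)
  then have B: "v1 * cnj v - y1 * cnj y = (r21 * y + r22 * y1) * cnj v' - y1 * cnj y"
    using \<open>e * cnj e = 1\<close> by simp
  have v'm: "(norm v')\<^sup>2 \<le> m" using m(2) \<open>norm e = 1\<close> by (simp add: v(1) norm_mult v'_def)
  define \<rho> where "\<rho> = Re (v1 * cnj v - y1 * cnj y)"
  have "Im (v1 * cnj v - y1 * cnj y) = (r11 * r22 - r12 * r21 - 1) * Im (y1 * cnj y)"
    unfolding B by (simp add: v'_def algebra_simps)
  then show "Im (v1 * cnj v - y1 * cnj y) = 0" using det by simp
  have det': "r11 * r22 = r12 * r21 + 1" using det by simp
  show "Re (v1 * cnj v - y1 * cnj y) \<le>
      (if r12 \<noteq> 0 then (\<bar>r11\<bar> + \<bar>r22\<bar> + 2) / \<bar>r12\<bar> else \<bar>r11 * r21\<bar>) * m"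
  proof (cases "r12 = 0")
    case True
    have "\<rho> = r11 * r21 * (norm y)\<^sup>2 + (r11 * r22 - 1) * Re (y1 * cnj y)"
      unfolding \<rho>_def B cmod_power2 using True by (simp add: v'_def power2_eq_square algebra_simps)
    then have "\<rho> = r11 * r21 * (norm y)\<^sup>2" using det' True by simp
    also have "\<dots> \<le> \<bar>r11 * r21\<bar> * m" using m(1) by (intro mult_mono) auto
    finally show ?thesis using True by (simp add: \<rho>_def)
  next
    case False
    \<comment> \<open>the last summand vanishes; it makes the equation a polynomial identity\<close>
    have "r12 * \<rho> = r22 * (norm v')\<^sup>2 + r11 * (norm y)\<^sup>2 - 2 * Re (v' * cnj y)
       - (r11 * r22 - r12 * r21 - 1) * (r11 * (norm y)\<^sup>2 + r12 * Re (y1 * cnj y))"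
      unfolding \<rho>_def B cmod_power2 by (simp add: v'_def power2_eq_square algebra_simps)
    then have eq: "r12 * \<rho> = r22 * (norm v')\<^sup>2 + r11 * (norm y)\<^sup>2 - 2 * Re (v' * cnj y)" using det by simp
    have "\<bar>Re (v' * cnj y)\<bar> \<le> norm v' * norm y"
      using abs_Re_le_cmod[of "v' * cnj y"] by (simp add: norm_mult)
    also have "2 * (norm v' * norm y) \<le> (norm v')\<^sup>2 + (norm y)\<^sup>2"
      using sum_squares_bound[of "norm v'" "norm y"] by simp
    then have "norm v' * norm y \<le> m" using m(1) v'm by simp
    finally have 3: "\<bar>Re (v' * cnj y)\<bar> \<le> m" .
    have 1: "\<bar>r22 * (norm v')\<^sup>2\<bar> \<le> \<bar>r22\<bar> * m" using v'm by (simp add: abs_mult mult_left_mono)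
    have 2: "\<bar>r11 * (norm y)\<^sup>2\<bar> \<le> \<bar>r11\<bar> * m" using m(1) by (simp add: abs_mult mult_left_mono)
    have "\<bar>r12\<bar> * \<bar>\<rho>\<bar> \<le> (\<bar>r11\<bar> + \<bar>r22\<bar> + 2) * m"
      unfolding abs_mult[symmetric] eq using 1 2 3 by (simp add: distrib_right)
    then have "\<bar>\<rho>\<bar> \<le> (\<bar>r11\<bar> + \<bar>r22\<bar> + 2) * m / \<bar>r12\<bar>" using False by (simp add: field_simps)
    then show ?thesis using False by (simp add: \<rho>_def)
  qed
qed

lemma sa_domain_boundary_form:
  assumes "valid_sa_data bc" and f: "f \<in> sa_domain a b p q w bc"
    and m: "(norm (f a))\<^sup>2 \<le> m" "(norm (f b))\<^sup>2 \<le> m"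
  defines "B \<equiv> quasi_deriv a b p f b * cnj (f b) - quasi_deriv a b p f a * cnj (f a)"
  shows "Im B = 0" and "Re B \<le> sa_const bc * m"
proof -
  have "Im B = 0 \<and> Re B \<le> sa_const bc * m"
  proof (cases bc)
    case (Sep l r)
    then have "satisfies_bparam l (f a) (quasi_deriv a b p f a)" "satisfies_bparam r (f b) (quasi_deriv a b p f b)"
      using f by (auto simp: D_sep_def)
    from satisfies_bparam_form[OF this(1) m(1)] satisfies_bparam_form[OF this(2) m(2)]
    show ?thesis unfolding Sep B_def by (cases l; cases r; auto simp: algebra_simps)
  next
    case (Coup \<phi> R)
    let ?U = "quasi_deriv a b p f" and ?e = "exp (\<i> * of_real \<phi>)"
    have eq: "(vector [f b, ?U b] :: complex^2) =
          ?e *s ((\<chi> i j. of_real (R $ i $ j)) *v vector [f a, ?U a])"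
      using f Coup by (simp add: D_coup_def)
    have "f b = ?e * (of_real (R $ 1 $ 1) * f a + of_real (R $ 1 $ 2) * ?U a)"
      "?U b = ?e * (of_real (R $ 2 $ 1) * f a + of_real (R $ 2 $ 2) * ?U a)"
      using arg_cong[OF eq, of "\<lambda>v. v $ 1"] arg_cong[OF eq, of "\<lambda>v. v $ 2"]
      by (simp_all add: matrix_vector_mult_def sum_2 vector_2)
    moreover have "R $ 1 $ 1 * R $ 2 $ 2 - R $ 1 $ 2 * R $ 2 $ 1 = 1"
      using assms(1) Coup by (simp add: det_2)
    moreover have "norm ?e = 1" by simp
    ultimately show ?thesis
      using coupled_form[of "f b" ?e "R $ 1 $ 1" "f a" "R $ 1 $ 2" "?U a" "?U b" "R $ 2 $ 1" "R $ 2 $ 2" m] m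
      unfolding Coup B_def sa_const.simps by blast
  qed
  then show "Im B = 0" "Re B \<le> sa_const bc * m" by auto
qed

lemma sa_const_nonneg: "sa_const bc \<ge> 0"
  by (cases bc rule: sa_const.cases) auto

section \<open>From eigenfunctions to solutions, and assembly of the bounds\<close>

lemma eigenfunction_sl_solution:
  assumes "a < b"
    and "integrable (lebesgue_on {a<..<b}) (\<lambda>x. 1 / p x)"
    and "integrable (lebesgue_on {a<..<b}) q" "integrable (lebesgue_on {a<..<b}) w"
    and p: "AE x in lebesgue_on {a<..<b}. p x > 0"
    and w: "AE x in lebesgue_on {a<..<b}. w x \<noteq> 0"
    and f: "f \<in> D_max a b p q w"
    and ev: "AE x in lebesgue_on {a<..<b}. tau a b p q w f x = z * f x"
  shows "sl_solution a b p q w f (quasi_deriv a b p f) z"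
proof
  let ?U = "quasi_deriv a b p f"
  show f_AC: "AC_on a b f" using f by (simp add: D_max_def)
  have "\<exists>u. is_quasi_deriv a b p f u"
    using f by (auto simp: D_max_def)
  then have "is_quasi_deriv a b p f ?U" unfolding quasi_deriv_def by (simp add: someI_ex)
  then show U_AC: "AC_on a b ?U"
    by (simp add: is_quasi_deriv_def)
  have U: "AE x in lebesgue_on {a<..<b}. ?U x = of_real (p x) * vector_derivative f (at x)"
    using \<open>is_quasi_deriv a b p f ?U\<close> by (simp add: is_quasi_deriv_def)
  \<comment> \<open>\<open>vector_derivative\<close> is a choice operator; it denotes an actual
    derivative where \<open>f\<close> is differentiable, which absolute continuity ensures almost
    everywhere.\<close>
  show "AE x in lebesgue_on {a<..<b}. (f has_vector_derivative ?U x / of_real (p x)) (at x)"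
    using U p AC_on_differentiable_AE[OF f_AC less_imp_le[OF \<open>a < b\<close>]]
    by eventually_elim (simp add: vector_derivative_works)
  show "AE x in lebesgue_on {a<..<b}.
      (?U has_vector_derivative of_real (q x) * f x - z * of_real (w x) * f x) (at x)"
    using ev w AC_on_differentiable_AE[OF U_AC less_imp_le[OF \<open>a < b\<close>]]
  proof eventually_elim
    case (elim x)
    then have "- vector_derivative ?U (at x) + of_real (q x) * f x = z * f x * of_real (w x)"
      by (simp add: tau_def field_simps)
    then have "vector_derivative ?U (at x) = of_real (q x) * f x - z * of_real (w x) * f x"
      by (simp add: algebra_simps)
    then show ?case using elim by (metis vector_derivative_works)
  qed
qed fact+

text \<open>Boundedness of \<open>g\<close> on the compact interval keeps the essential supremum
  below infinity, where \<open>real_of_ereal\<close> would return its default 0.\<close>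

lemma AE_abs_le_norm_Linf:
  assumes g: "continuous_on {a..b} g"
  shows "AE x in lebesgue_on {a<..<b}. \<bar>g x\<bar> \<le> norm_Linf a b g"
proof -
  let ?M = "lebesgue_on {a<..<b}" and ?s = "esssup (lebesgue_on {a<..<b}) (\<lambda>t. ereal \<bar>g t\<bar>)"
  obtain C where C: "\<And>x. x \<in> {a..b} \<Longrightarrow> norm (g x) \<le> C"
    using compact_imp_bounded[OF compact_continuous_image[OF g compact_Icc]]
    unfolding bounded_pos by blast
  have meas: "g \<in> borel_measurable ?M"
    by (intro continuous_imp_measurable_on_sets_lebesgue continuous_on_subset[OF g]) auto
  have "?s \<le> ereal C"
  proof (rule esssup_I)
    show "AE x in ?M. ereal \<bar>g x\<bar> \<le> ereal C"
      by (rule AE_I2) (use C in \<open>auto simp: space_restrict_space\<close>)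
  qed (use meas in measurable)
  moreover have "AE x in ?M. ereal \<bar>g x\<bar> \<le> ?s" by (rule esssup_AE)
  ultimately show ?thesis
    unfolding norm_Linf_def by (cases ?s) auto
qed

theorem theorem3p2:
  fixes a b \<epsilon> \<alpha> \<beta> \<gamma> :: real
    and p q w g :: "real \<Rightarrow> real"
    and bc :: sa_data
    and z :: complex
  assumes "a < b"
    and "p \<in> borel_measurable (lebesgue_on {a<..<b})"
    and "q \<in> borel_measurable (lebesgue_on {a<..<b})"
    and "w \<in> borel_measurable (lebesgue_on {a<..<b})"
    and "integrable (lebesgue_on {a<..<b}) (\<lambda>x. 1 / p x)"
    and "integrable (lebesgue_on {a<..<b}) q"
    and "integrable (lebesgue_on {a<..<b}) w"
    and "AE x in lebesgue_on {a<..<b}. p x > 0"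
    and "AE x in lebesgue_on {a<..<b}. w x \<noteq> 0"
    and "emeasure lebesgue {x \<in> {a<..<b}. w x > 0} > 0"
    and "emeasure lebesgue {x \<in> {a<..<b}. w x < 0} > 0"
    and "valid_sa_data bc"
    and "\<alpha> = sa_const bc + norm_L1 a b (\<lambda>x. min 0 (q x))"
    and "\<beta> = sqrt (\<alpha> * (1 / norm_L1 a b (\<lambda>x. 1 / p x) + \<alpha>)) + \<alpha>"
    and "\<gamma> = sqrt (2 * \<beta> + 1 / norm_L1 a b (\<lambda>x. 1 / p x))"
    and "AC_on a b g" and "g a = 0" and "g b = 0"
    and "deriv g \<in> L2 a b p"
    and "AE x in lebesgue_on {a<..<b}. g x * w x > 0"
    and "\<epsilon> > 0"
    and "measure (mu a b (\<lambda>x. 1 / p x)) {x \<in> {a<..<b}. p x * g x * w x < \<epsilon>} \<le> 1 / (2 * \<gamma>\<^sup>2)"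
    and "is_eigenvalue a b p q w (sa_domain a b p q w bc) z"
    and "z \<notin> \<real>"
  shows "\<bar>Im z\<bar> \<le> 2 / \<epsilon> * \<beta> * \<gamma> * norm_L2 a b p (deriv g) \<and>
         \<bar>Re z\<bar> \<le> 2 / \<epsilon> * (\<beta> * \<gamma> * norm_L2 a b p (deriv g)
                            + (\<beta>\<^sup>2 + \<gamma>\<^sup>2 * norm_L1 a b q) * norm_Linf a b g)"
proof -
  let ?M = "lebesgue_on {a<..<b}"
  note p_meas [measurable] = assms(2) and w_meas [measurable] = assms(4) and p_pos = assms(8) and g_AC = assms(16)
  obtain f where f: "f \<in> sa_domain a b p q w bc" and nz: "\<not> (AE x in ?M. f x = 0)"
    and ev: "AE x in ?M. tau a b p q w f x = z * f x"
    using assms(23) by (auto simp: is_eigenvalue_def)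
  have "f \<in> D_max a b p q w" using f by (cases bc) (auto simp: D_sep_def D_coup_def)
  then interpret sl_solution a b p q w f "quasi_deriv a b p f" z
    by (rule eigenfunction_sl_solution[OF assms(1,5,6,7,8,9) _ ev])
  have P: "norm_L1 a b (\<lambda>x. 1 / p x) = P"
    unfolding norm_L1_def P_def
  proof (rule integral_cong_AE)
    show "AE x in ?M. \<bar>1 / p x\<bar> = 1 / p x" using p_pos by eventually_elim simp
  qed measurable
  note bd = sa_domain_boundary_form[OF assms(12) f]
  \<comment> \<open>Any common bound of the two boundary values serves here, as the conclusion does
    not mention it; the maximum is one.\<close>
  have Im_bdry: "Im bdry = 0"
    unfolding bdry_def by (rule bd(1)[of "max ((norm (f a))\<^sup>2) ((norm (f b))\<^sup>2)"]) auto
  have Re_bdry: "\<forall>m. (norm (f a))\<^sup>2 \<le> m \<longrightarrow> (norm (f b))\<^sup>2 \<le> m \<longrightarrow> Re bdry \<le> sa_const bc * m"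
    unfolding bdry_def using bd(2) by blast
  have Im_z: "Im z \<noteq> 0" using assms(24) by (simp add: complex_is_Real_iff)
  note est = growth_estimates[OF Im_bdry Re_bdry Im_z sa_const_nonneg
      assms(13)[unfolded norm_L1_def] assms(14)[unfolded P]]
  have "\<alpha> \<ge> 0"
    unfolding assms(13) norm_L1_def
    by (intro add_nonneg_nonneg sa_const_nonneg Bochner_Integration.integral_nonneg) simp
  then have "\<beta> \<ge> 0" using assms(14) P P_pos by simp
  \<comment> \<open>The summand \<open>1 / P\<close> gives strict positivity even for
    \<open>\<beta> = 0\<close>, so \<gamma> is positive and the square root can be squared
    back.\<close>
  then have pos: "2 * \<beta> + 1 / P > 0" using P_pos by (simp add: add_nonneg_pos)
  then have "\<gamma> > 0" and \<gamma>2: "\<gamma>\<^sup>2 = 2 * \<beta> + 1 / P" using assms(15) P by auto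
  have F2: "\<forall>x\<in>{a..b}. F2 x \<le> \<gamma>\<^sup>2 * K" using est(2) \<gamma>2 by simp
  have g_cont: "continuous_on {a..b} g" by (rule AC_on_imp_continuous_on[OF g_AC])
  have g_meas [measurable]: "g \<in> borel_measurable ?M"
    by (intro continuous_imp_measurable_on_sets_lebesgue continuous_on_subset[OF g_cont]) auto
  have g_deriv: "AE x in ?M. (g has_real_derivative deriv g x) (at x)"
    using AC_on_differentiable_AE_real[OF g_AC less_imp_le[OF \<open>a < b\<close>]]
    by (simp add: AE_lebesgue_on_iff_negligible DERIV_deriv_iff_real_differentiable)
  have dg_meas: "deriv g \<in> borel_measurable ?M"
    and "integrable (mu a b p) (\<lambda>t. (norm (deriv g t))\<^sup>2)"
    using assms(19) by (auto simp: L2_def mu_def)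
  then have int_g: "integrable ?M (\<lambda>x. p x * (deriv g x)\<^sup>2)"
    using p_pos unfolding mu_def
    by (subst (asm) integrable_density) (auto elim: eventually_mono)
  have G: "norm_L2 a b p (deriv g) = sqrt (\<integral>x. p x * (deriv g x)\<^sup>2 \<partial>?M)"
    unfolding norm_L2_def mu_def using dg_meas p_pos
    by (subst integral_density) (auto elim: eventually_mono)
  let ?S = "{x \<in> {a<..<b}. p x * g x * w x < \<epsilon>}"
  have "?S = {x \<in> space ?M. p x * g x * w x < \<epsilon>}" by (auto simp: space_restrict_space)
  also have "\<dots> \<in> sets ?M" by measurable
  finally have S_meas: "?S \<in> sets ?M" .
  have "measure (mu a b (\<lambda>x. 1 / p x)) ?S = (\<integral>x. indicator ?S x \<partial>mu a b (\<lambda>x. 1 / p x))"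
    using sets.sets_into_space[OF S_meas] by (simp add: mu_def Int_absorb2)
  also have "\<dots> = (\<integral>x. indicator ?S x / p x \<partial>?M)"
    unfolding mu_def using S_meas p_pos by (subst integral_density) (auto elim: eventually_mono)
  finally have S: "(\<integral>x. indicator ?S x / p x \<partial>?M) \<le> 1 / (2 * \<gamma>\<^sup>2)" using assms(22) by simp
  have mass: "\<epsilon> * K / 2 \<le> (\<integral>x. g x * (w x * F2 x) \<partial>?M)"
    by (rule weighted_mass_ge[OF g_cont assms(20) \<open>\<epsilon> > 0\<close> \<open>\<gamma> > 0\<close> S S_meas F2])
  show ?thesis
    unfolding G norm_L1_def
    using eigenvalue_bounds[OF nz est(1) F2 \<open>\<gamma> > 0\<close> g_AC assms(17,18) g_deriv dg_meas int_g mass \<open>\<epsilon> > 0\<close>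
        AE_abs_le_norm_Linf[OF g_cont]]
    by (rule conjI)
qed

end
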